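(* Let $N\ge1$ and consider the bi-orthogonal polynomial system on the unit circle for the regular semi-classical weight with distinct finite singularities $0,t_1,\dots,t_N,1$ and exponents $\rho_0,\rho_1,\dots,\rho_N,\rho$. Let $\omega_n^1,\dots,\omega_n^N$ be defined from the spectral coefficient $\Omega_n$ as in the context and define $$t_jf_n^j:=\frac{\Theta_n(t_j)}{\Theta_n(1)},\qquad j=1,\dots,N.$$ Then the following system of $2N$ coupled first-order recurrence relations in $n$ for the variables $\{f_n^j,\omega_n^j\}_{j=1}^N$ completely characterises the bi-orthogonal polynomial system, in the sense that these variables satisfy the relations and initial conditions below and are recursively determined by them. For $j=1,\dots,N$ and $n\ge0$, $$t_jf_n^jf_{n+1}^j=\frac{\left[(n-\rho_0)\prod_{k\ne j}t_k+\sum_{l=1}^Nt_j^{l-1}\omega_n^l+(-1)^N(1+m_0)t_j^N\right]}{\left[(n-\rho_0)\prod_kt_k+\sum_{l=1}^N\omega_n^l+(-1)^N(1+m_0)\right]}\times\frac{\left[n\prod_{k\ne j}t_k+\sum_{l=1}^Nt_j^{l-1}(\omega_n^l+(-1)^lm_{N+1-l})+(-1)^Nt_j^N\right]}{\left[n\prod_kt_k+\sum_{l=1}^N(\omega_n^l+(-1)^lm_{N+1-l})+(-1)^N\right]},$$ and for $j=1,\dots,N$ and $n\ge1$, $$\begin{aligned}\omega_n^j+\omega_{n-1}^j+(-1)^jm_{N+1-j}={}&(-1)^j(n-1)e_{N+1-j}(T\cup\{1\})\\&+(-1)^j(n-\rho_0)\frac{\Delta(T)e_{N-j}(T)+\sum_{l=1}^N(-1)^{N-1+l}t_l\Delta(T_l\cup\{1\})e_{N-j}(T_l\cup\{1\})f_n^l}{\Delta(T)+\sum_{l=1}^N(-1)^{N-1+l}\Delta(T_l\cup\{1\})f_n^l}\\&-(-1)^j(n+1+m_0)\frac{\Delta(T)e_{N+1-j}(T)+\sum_{l=1}^N(-1)^{N-1+l}t_l\Delta(T_l\cup\{1\})e_{N+1-j}(T_l\cup\{1\})f_n^l}{\Delta(T)+\sum_{l=1}^N(-1)^{N-1+l}t_l\Delta(T_l\cup\{1\})f_n^l}.\end{aligned}$$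 The recurrence relations are subject to the initial conditions $$f_0^j=\frac{2V(t_j)-\kappa_0^2U(t_j)}{t_j[2V(1)-\kappa_0^2U(1)]},$$ $$(-1)^N\omega_0^j=\frac12[z^j]\left(2V-\kappa_0^2U\right)-\frac{w_0}{2w_{-1}}[z^{j-1}]\left(2V-\kappa_0^2U\right)$$ for $j=1,\dots,N$, where $[z^l](\cdot)$ denotes the coefficient of $z^l$ in the polynomial.
   Context: **Bi-orthogonal system.** $\mathbb T$ is the unit circle and $w$ a complex weight on it, $w_k=\int_{\mathbb T}\frac{d\zeta}{2\pi i\zeta}w(\zeta)\zeta^{-k}$, $I_n=\det[w_{i-j}]_{i,j=0}^{n-1}$, $I_0=1$; it is assumed that $I_n\ne0$ for all $n$. $\phi_n,\bar\phi_n$ are polynomials of degree $n$ with the same leading coefficient $\kappa_n$ (and $\bar\phi_n$ is not in general the complex conjugate of $\phi_n$) such that $\int_{\mathbb T}\frac{d\zeta}{2\pi i\zeta}w(\zeta)\phi_m(\zeta)\bar\phi_n(\bar\zeta)=\delta_{m,n}$; thus $\kappa_0^2=1/w_0$. $r_n=\phi_n(0)/\kappa_n$. Put $\phi_n^*(z)=z^n\bar\phi_n(1/z)$, $F(z)=\int_{\mathbb T}\frac{d\zeta}{2\pi i\zeta}\frac{\zeta+z}{\zeta-z}w(\zeta)$, and $\epsilon_n(z)=\int_{\mathbb T}\frac{d\zeta}{2\pi i\zeta}\frac{\zeta+z}{\zeta-z}w(\zeta)\phi_n(\zeta)$, $\epsilon_n^*(z)=-z^n\int_{\mathbb T}\frac{d\zeta}{2\pi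 i\zeta}\frac{\zeta+z}{\zeta-z}w(\zeta)\bar\phi_n(\bar\zeta)$ for $n\ge1$, with $\epsilon_0=\kappa_0[w_0+F]$, $\epsilon_0^*=\kappa_0[w_0-F]$. Let $Y_n=\begin{pmatrix}\phi_n&\epsilon_n/w\\ \phi_n^*&-\epsilon_n^*/w\end{pmatrix}$. **Notation.** $T=\{t_1,\dots,t_N\}$, $T_j=T\setminus\{t_j\}$; $e_l(X)$ is the $l$-th elementary symmetric function of the elements of $X$, $e_0=1$ (and $e_l(X)=0$ for $l>|X|$); $e_l$ without argument means $e_l(T\cup\{1\})$. $\Delta(T)=\prod_{1\le j<k\le N}(t_k-t_j)$ is the Vandermonde determinant; $\Delta(T_l\cup\{1\})$ is the Vandermonde product for the ordered list $t_1,\dots,t_{l-1},t_{l+1},\dots,t_N,1$. **Weight.** $W(z)=z(z-1)\prod_{j=1}^N(z-t_j)=z\sum_{l=0}^{N+1}(-1)^{N+1-l}e_{N+1-l}z^l$ and $$\frac{w'}{w}=\frac{2V}{W},\qquad 2V(z)=W(z)\left\{\frac{\rho_0}z+\frac{\rho}{z-1}+\sum_{j=1}^N\frac{\rho_j}{z-t_j}\right\}=\sum_{l=0}^{N+1}(-1)^{N+1-l}m_{N+1-l}z^l,$$ defining $m_0,\dots,m_{N+1}$; in particular $m_0=\rho_0+\rho+\sum_{j=1}^N\rho_j$ and $m_{N+1}=\rho_0e_{N+1}$. The exponents are not non-negative integers. The weight is assumed single-valued around the circle, $w(e^{2\pi i})=w(1)$, and such that $F$ satisfies $WF'=2VF+U$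 with a polynomial $U=\sum_{l=0}^{N+1}u_lz^l$, where $u_0=(-1)^Nw_0m_{N+1}$, $u_{N+1}=w_0m_0$ and, for $j=1,\dots,N$, $$u_j=(-1)^{N-j}w_0m_{N+1-j}+2\sum_{l=0}^{j-1}(-1)^{N+1-l}\left[(j-l)e_{N+1-l}-m_{N+1-l}\right]w_{j-l}.$$ The Toeplitz elements satisfy $\sum_{l=0}^{N+1}(-1)^l[(j-l)e_{N+1-l}-m_{N+1-l}]w_{j-l}=0$, $j\in\mathbb Z$, with $N+1$ consecutive elements as arbitrary initial values. **Spectral coefficients.** $\frac{d}{dz}Y_n=A_nY_n$ with $$A_n=\frac1W\begin{pmatrix}-\left[\Omega_n+V-\frac{\kappa_{n+1}}{\kappa_n}z\Theta_n\right]&\frac{\phi_{n+1}(0)}{\kappa_n}\Theta_n\\ -\frac{\bar\phi_{n+1}(0)}{\kappa_n}z\Theta_n^*&\Omega_n^*-V-\frac{\kappa_{n+1}}{\kappa_n}\Theta_n^*\end{pmatrix},$$ which defines $\Theta_n,\Omega_n,\Theta_n^*,\Omega_n^*$. Here $\Theta_n,\Omega_n$ are polynomials in $z$ of degrees $N$, $N+1$ of the form $$\frac{\kappa_{n+1}}{\kappa_n}\Theta_n(z)=(-1)^N(ne_{N+1}-m_{N+1})\frac{r_n}{r_{n+1}}+\sum_{l=1}^{N-1}\vartheta_n^lz^l+(n+1+m_0)z^N,$$ $$\Omega_n(z)=(-1)^N(ne_{N+1}-\tfrac12m_{N+1})+(-1)^N\sum_{l=1}^N\left(\omega_n^l+\tfrac12(-1)^lm_{N+1-l}\right)z^l+(1+\tfrac12m_0)z^{N+1},$$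 which defines $\vartheta_n^l$ and $\omega_n^l$. It is understood that parameters are generic, so that all quantities appearing in denominators or needed to solve the recurrences are non-zero. *)

theory Defs
  imports "HOL-Complex_Analysis.Complex_Analysis" "Jordan_Normal_Form.Determinant"
begin

section \<open>Symmetric functions and Vandermonde products\<close>

definition esym :: "complex set \<Rightarrow> nat \<Rightarrow> complex" where
  "esym X l = (\<Sum>S | S \<subseteq> X \<and> card S = l. \<Prod>x\<in>S. x)"

definition vandermonde :: "complex list \<Rightarrow> complex" where
  "vandermonde xs = (\<Prod>(j, k) | j < k \<and> k < length xs. xs ! k - xs ! j)"

text \<open>The singularities \<open>t\<^sub>1, \<dots>, t\<^sub>N\<close> are the values of \<open>t :: nat \<Rightarrow> complex\<close> on \<open>{1..N}\<close>.
  \<open>T_list\<close> and \<open>T_del_one_list\<close> are the ordered lists underlying \<open>\<Delta>(T)\<close> and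
  \<open>\<Delta>(T\<^sub>l \<union> {1})\<close>; the latter ends with \<open>1\<close>.\<close>

definition T_set :: "nat \<Rightarrow> (nat \<Rightarrow> complex) \<Rightarrow> complex set" where
  "T_set N t = t ` {1..N}"

definition T_del_one_set :: "nat \<Rightarrow> (nat \<Rightarrow> complex) \<Rightarrow> nat \<Rightarrow> complex set" where
  "T_del_one_set N t l = t ` ({1..N} - {l}) \<union> {1}"

definition T_list :: "nat \<Rightarrow> (nat \<Rightarrow> complex) \<Rightarrow> complex list" where
  "T_list N t = map t [1..<N+1]"

definition T_del_one_list :: "nat \<Rightarrow> (nat \<Rightarrow> complex) \<Rightarrow> nat \<Rightarrow> complex list" where
  "T_del_one_list N t l = map t [1..<l] @ map t [l+1..<N+1] @ [1]"

section \<open>The bi-orthogonal system on the unit circle\<close>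

definition circle_int :: "(complex \<Rightarrow> complex) \<Rightarrow> complex" where
  "circle_int g = contour_integral (circlepath 0 1) (\<lambda>\<zeta>. g \<zeta> / (2 * of_real pi * \<i> * \<zeta>))"

definition toeplitz_elem :: "(complex \<Rightarrow> complex) \<Rightarrow> int \<Rightarrow> complex" where
  "toeplitz_elem w k = circle_int (\<lambda>\<zeta>. w \<zeta> * \<zeta> powi (- k))"

definition toeplitz_det :: "(complex \<Rightarrow> complex) \<Rightarrow> nat \<Rightarrow> complex" where
  "toeplitz_det w n = Determinant.det (Matrix.mat n n (\<lambda>(i, j). toeplitz_elem w (int i - int j)))"

text \<open>\<open>\<phi>b\<close> is the second family \<open>\<phi>\<close>-bar; it is independent of \<open>\<phi>\<close>, not its complex conjugate.\<close>

definition biorthogonal_system ::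
  "(complex \<Rightarrow> complex) \<Rightarrow> (nat \<Rightarrow> complex poly) \<Rightarrow> (nat \<Rightarrow> complex poly) \<Rightarrow> bool" where
  "biorthogonal_system w \<phi> \<phi>b \<longleftrightarrow>
     (\<forall>n. degree (\<phi> n) = n \<and> degree (\<phi>b n) = n \<and> lead_coeff (\<phi> n) = lead_coeff (\<phi>b n)) \<and>
     (\<forall>m n. circle_int (\<lambda>\<zeta>. w \<zeta> * poly (\<phi> m) \<zeta> * poly (\<phi>b n) (cnj \<zeta>)) = (if m = n then 1 else 0))"

definition caratheodory :: "(complex \<Rightarrow> complex) \<Rightarrow> complex \<Rightarrow> complex" where
  "caratheodory w z = circle_int (\<lambda>\<zeta>. (\<zeta> + z) / (\<zeta> - z) * w \<zeta>)"

definition epsilon ::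
  "(complex \<Rightarrow> complex) \<Rightarrow> (nat \<Rightarrow> complex poly) \<Rightarrow> nat \<Rightarrow> complex \<Rightarrow> complex" where
  "epsilon w \<phi> n z =
     (if n = 0 then lead_coeff (\<phi> 0) * (toeplitz_elem w 0 + caratheodory w z)
      else circle_int (\<lambda>\<zeta>. (\<zeta> + z) / (\<zeta> - z) * w \<zeta> * poly (\<phi> n) \<zeta>))"

text \<open>Since \<open>\<phi>\<^sub>0\<close> and \<open>\<phi>b\<^sub>0\<close> are the same constant \<open>\<kappa>\<^sub>0\<close>, \<open>\<phi>b\<close> suffices as argument.\<close>

definition epsilon_star ::
  "(complex \<Rightarrow> complex) \<Rightarrow> (nat \<Rightarrow> complex poly) \<Rightarrow> nat \<Rightarrow> complex \<Rightarrow> complex" where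
  "epsilon_star w \<phi>b n z =
     (if n = 0 then lead_coeff (\<phi>b 0) * (toeplitz_elem w 0 - caratheodory w z)
      else - (z ^ n) * circle_int (\<lambda>\<zeta>. (\<zeta> + z) / (\<zeta> - z) * w \<zeta> * poly (\<phi>b n) (cnj \<zeta>)))"

text \<open>As \<open>\<phi>b n\<close> has degree \<open>n\<close>, \<open>reflect_poly (\<phi>b n)\<close> is \<open>z\<^sup>n \<phi>b\<^sub>n(1/z)\<close>.\<close>

definition Y_mat ::
  "(complex \<Rightarrow> complex) \<Rightarrow> (nat \<Rightarrow> complex poly) \<Rightarrow> (nat \<Rightarrow> complex poly) \<Rightarrow> nat \<Rightarrow> complex
    \<Rightarrow> complex mat" where
  "Y_mat w \<phi> \<phi>b n z = mat_of_rows_list 2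
     [[poly (\<phi> n) z, epsilon w \<phi> n z / w z],
      [poly (reflect_poly (\<phi>b n)) z, - epsilon_star w \<phi>b n z / w z]]"

definition A_mat ::
  "complex poly \<Rightarrow> complex poly \<Rightarrow> (nat \<Rightarrow> complex poly) \<Rightarrow> (nat \<Rightarrow> complex poly)
    \<Rightarrow> (nat \<Rightarrow> complex poly) \<Rightarrow> (nat \<Rightarrow> complex poly)
    \<Rightarrow> (nat \<Rightarrow> complex \<Rightarrow> complex) \<Rightarrow> (nat \<Rightarrow> complex \<Rightarrow> complex) \<Rightarrow> nat \<Rightarrow> complex \<Rightarrow> complex mat" where
  "A_mat W V \<phi> \<phi>b \<Theta> \<Omega> \<Theta>s \<Omega>s n z =
     (let \<kappa> = (\<lambda>k. lead_coeff (\<phi> k)) in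
      (1 / poly W z) \<cdot>\<^sub>m mat_of_rows_list 2
       [[- (poly (\<Omega> n) z + poly V z - \<kappa> (n+1) / \<kappa> n * z * poly (\<Theta> n) z),
         poly (\<phi> (n+1)) 0 / \<kappa> n * poly (\<Theta> n) z],
        [- (poly (\<phi>b (n+1)) 0 / \<kappa> n) * z * \<Theta>s n z,
         \<Omega>s n z - poly V z - \<kappa> (n+1) / \<kappa> n * \<Theta>s n z]])"

section \<open>Regular semi-classical weights\<close>

text \<open>The weight is given on the unit circle, on which some singular points lie (\<open>1\<close> always does).
  Away from them it extends analytically to a neighbourhood \<open>D\<close>, which is where \<open>w\<close> is available
  off the circle in \<open>Y_mat\<close>. As \<open>w\<close> is a function of the point \<open>\<zeta>\<close> and not of its argument, it is
  single-valued around the circle. Different arcs may carry different branches or multiples.\<close>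

definition semiclassical_weight ::
  "complex poly \<Rightarrow> complex poly \<Rightarrow> complex set \<Rightarrow> (complex \<Rightarrow> complex) \<Rightarrow> bool" where
  "semiclassical_weight W V D w \<longleftrightarrow>
     open D \<and> {z \<in> sphere 0 1. poly W z \<noteq> 0} \<subseteq> D \<and>
     (\<forall>z\<in>D. poly W z \<noteq> 0 \<and> w z \<noteq> 0 \<and>
        (w has_field_derivative 2 * poly V z / poly W z * w z) (at z)) \<and>
     (\<lambda>x. w (circlepath 0 1 x)) absolutely_integrable_on {0..1}"

section \<open>The recurrence relations\<close>

text \<open>In all relations the sequences are indexed as \<open>f n j\<close>, \<open>\<omega> n j\<close> with \<open>j \<in> {1..N}\<close>.\<close>

definition f_den1 ::
  "nat \<Rightarrow> (nat \<Rightarrow> complex) \<Rightarrow> complex \<Rightarrow> (nat \<Rightarrow> complex) \<Rightarrow> (nat \<Rightarrow> nat \<Rightarrow> complex) \<Rightarrow> nat \<Rightarrow> complex" where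
  "f_den1 N t \<rho>0 m \<omega> n =
     (of_nat n - \<rho>0) * (\<Prod>k=1..N. t k) + (\<Sum>l=1..N. \<omega> n l) + (-1) ^ N * (1 + m 0)"

definition f_den2 ::
  "nat \<Rightarrow> (nat \<Rightarrow> complex) \<Rightarrow> (nat \<Rightarrow> complex) \<Rightarrow> (nat \<Rightarrow> nat \<Rightarrow> complex) \<Rightarrow> nat \<Rightarrow> complex" where
  "f_den2 N t m \<omega> n =
     of_nat n * (\<Prod>k=1..N. t k) + (\<Sum>l=1..N. \<omega> n l + (-1) ^ l * m (N+1-l)) + (-1) ^ N"

definition f_relation ::
  "nat \<Rightarrow> (nat \<Rightarrow> complex) \<Rightarrow> complex \<Rightarrow> (nat \<Rightarrow> complex) \<Rightarrow> (nat \<Rightarrow> nat \<Rightarrow> complex)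
    \<Rightarrow> (nat \<Rightarrow> nat \<Rightarrow> complex) \<Rightarrow> nat \<Rightarrow> nat \<Rightarrow> bool" where
  "f_relation N t \<rho>0 m f \<omega> n j \<longleftrightarrow>
     t j * f n j * f (n+1) j =
       ((of_nat n - \<rho>0) * (\<Prod>k\<in>{1..N}-{j}. t k) + (\<Sum>l=1..N. t j ^ (l-1) * \<omega> n l)
          + (-1) ^ N * (1 + m 0) * t j ^ N) / f_den1 N t \<rho>0 m \<omega> n
     * ((of_nat n * (\<Prod>k\<in>{1..N}-{j}. t k)
          + (\<Sum>l=1..N. t j ^ (l-1) * (\<omega> n l + (-1) ^ l * m (N+1-l)))
          + (-1) ^ N * t j ^ N) / f_den2 N t m \<omega> n)"

definition omega_num ::
  "nat \<Rightarrow> (nat \<Rightarrow> complex) \<Rightarrow> (nat \<Rightarrow> nat \<Rightarrow> complex) \<Rightarrow> nat \<Rightarrow> nat \<Rightarrow> complex" where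
  "omega_num N t f n i =
     vandermonde (T_list N t) * esym (T_set N t) i
     + (\<Sum>l=1..N. (-1) ^ (N-1+l) * t l * vandermonde (T_del_one_list N t l)
                   * esym (T_del_one_set N t l) i * f n l)"

definition omega_den1 ::
  "nat \<Rightarrow> (nat \<Rightarrow> complex) \<Rightarrow> (nat \<Rightarrow> nat \<Rightarrow> complex) \<Rightarrow> nat \<Rightarrow> complex" where
  "omega_den1 N t f n =
     vandermonde (T_list N t)
     + (\<Sum>l=1..N. (-1) ^ (N-1+l) * vandermonde (T_del_one_list N t l) * f n l)"

definition omega_den2 ::
  "nat \<Rightarrow> (nat \<Rightarrow> complex) \<Rightarrow> (nat \<Rightarrow> nat \<Rightarrow> complex) \<Rightarrow> nat \<Rightarrow> complex" where
  "omega_den2 N t f n =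
     vandermonde (T_list N t)
     + (\<Sum>l=1..N. (-1) ^ (N-1+l) * t l * vandermonde (T_del_one_list N t l) * f n l)"

text \<open>To be used for \<open>n \<ge> 1\<close> only (\<open>n - 1\<close> is truncated).\<close>

definition omega_relation ::
  "nat \<Rightarrow> (nat \<Rightarrow> complex) \<Rightarrow> complex \<Rightarrow> (nat \<Rightarrow> complex) \<Rightarrow> (nat \<Rightarrow> nat \<Rightarrow> complex)
    \<Rightarrow> (nat \<Rightarrow> nat \<Rightarrow> complex) \<Rightarrow> nat \<Rightarrow> nat \<Rightarrow> bool" where
  "omega_relation N t \<rho>0 m f \<omega> n j \<longleftrightarrow>
     \<omega> n j + \<omega> (n-1) j + (-1) ^ j * m (N+1-j) =
       (-1) ^ j * (of_nat n - 1) * esym (T_set N t \<union> {1}) (N+1-j)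
     + (-1) ^ j * (of_nat n - \<rho>0) * (omega_num N t f n (N-j) / omega_den1 N t f n)
     - (-1) ^ j * (of_nat n + 1 + m 0) * (omega_num N t f n (N+1-j) / omega_den2 N t f n)"

text \<open>Here \<open>G\<close> stands for the polynomial \<open>2V - \<kappa>\<^sub>0\<^sup>2 U\<close>.\<close>

definition initial_conditions ::
  "nat \<Rightarrow> (nat \<Rightarrow> complex) \<Rightarrow> (complex \<Rightarrow> complex) \<Rightarrow> complex poly
    \<Rightarrow> (nat \<Rightarrow> nat \<Rightarrow> complex) \<Rightarrow> (nat \<Rightarrow> nat \<Rightarrow> complex) \<Rightarrow> bool" where
  "initial_conditions N t w G f \<omega> \<longleftrightarrow>
     (\<forall>j\<in>{1..N}.
        f 0 j = poly G (t j) / (t j * poly G 1) \<and>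
        (-1) ^ N * \<omega> 0 j =
          1 / 2 * coeff G j - toeplitz_elem w 0 / (2 * toeplitz_elem w (-1)) * coeff G (j-1))"

end

theory Submission
  imports Defs
begin

text \<open>Orthogonality gives a matrix recurrence \<open>Y\<^sub>n\<^sub>+\<^sub>1 = K\<^sub>n Y\<^sub>n\<close> with \<open>det K\<^sub>n = z\<close>, hence
  \<open>det Y\<^sub>n = - 2 z\<^sup>n / w\<close>, so that \<open>Y\<^sub>n\<close> is invertible off the circle. Differentiating
  both structures yields the trace \<open>n / z - 2 V / W\<close> of \<open>A\<^sub>n\<close> and the compatibility relation
  \<open>K\<^sub>n' + K\<^sub>n A\<^sub>n = A\<^sub>n\<^sub>+\<^sub>1 K\<^sub>n\<close>. One entry of it is linear in \<open>\<Omega>\<^sub>n\<close>, \<open>\<Omega>\<^sub>n\<^sub>+\<^sub>1\<close> and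
  \<open>\<Theta>\<^sub>n\<^sub>+\<^sub>1\<close>; interpolating \<open>\<Theta>\<^sub>n\<close> at \<open>t\<^sub>1, \<dots>, t\<^sub>N, 1\<close>, with its scale fixed by the leading
  coefficient and \<open>r\<^sub>n\<^sub>+\<^sub>1 / r\<^sub>n\<close> by the constant one, turns it into the recurrence for \<open>\<omega>\<close>.
  At a zero \<open>z \<noteq> 0\<close> of \<open>W\<close> the number \<open>det (W A\<^sub>n)\<close> does not depend on \<open>n\<close>, and it vanishes for
  \<open>n = 0\<close> because the first column of \<open>Y\<^sub>0\<close> is constant. Therefore \<open>\<Omega>\<^sub>n\<^sup>2 - V\<^sup>2\<close> is a multiple of
  \<open>z \<Theta>\<^sub>n \<Theta>\<^sub>n\<^sub>+\<^sub>1\<close> there, with a factor depending only on \<open>n\<close> that drops out of the quotient of the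
  values at \<open>t\<^sub>j\<close> and \<open>1\<close>: this is the recurrence for \<open>f\<close>.\<close>

section \<open>Biorthogonal polynomials for a Toeplitz form\<close>

text \<open>Reversal relative to a fixed bound \<open>n\<close> instead of the degree, unlike
  \<open>reflect_poly\<close>: this makes it linear, and an involution on polynomials of degree at
  most \<open>n\<close>.\<close>

definition rev_poly :: "nat \<Rightarrow> 'a::comm_semiring_1 poly \<Rightarrow> 'a poly" where
  "rev_poly n p = (\<Sum>i\<le>n. monom (coeff p (n - i)) i)"

lemma coeff_rev_poly: "coeff (rev_poly n p) i = (if i \<le> n then coeff p (n - i) else 0)"
  by (simp add: rev_poly_def coeff_sum coeff_monom)

lemma degree_rev_poly: "degree (rev_poly n p) \<le> n"
  by (intro degree_le) (simp add: coeff_rev_poly)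

lemma rev_poly_add: "rev_poly n (p + q) = rev_poly n p + rev_poly n q"
  by (intro poly_eqI) (simp add: coeff_rev_poly)

lemma rev_poly_smult: "rev_poly n (Polynomial.smult c p) = Polynomial.smult c (rev_poly n p)"
  by (intro poly_eqI) (simp add: coeff_rev_poly)

lemma rev_poly_rev_poly: "degree p \<le> n \<Longrightarrow> rev_poly n (rev_poly n p) = p"
  by (intro poly_eqI) (auto simp: coeff_rev_poly coeff_eq_0)

lemma rev_poly_pCons_0: "rev_poly (Suc n) (pCons 0 p) = rev_poly n p"
  by (intro poly_eqI) (auto simp: coeff_rev_poly coeff_pCons Suc_diff_le le_Suc_eq split: nat.split)

lemma rev_poly_Suc: "degree p \<le> n \<Longrightarrow> rev_poly (Suc n) p = pCons 0 (rev_poly n p)"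
  by (intro poly_eqI) (auto simp: coeff_rev_poly coeff_pCons coeff_eq_0 split: nat.split)

lemma rev_poly_degree: "rev_poly (degree p) p = reflect_poly p"
  by (intro poly_eqI) (auto simp: coeff_rev_poly coeff_reflect_poly)

lemma poly_rev_poly:
  fixes z :: "'a::field"
  assumes "degree p \<le> n" "z \<noteq> 0"
  shows "poly (rev_poly n p) z = z ^ n * poly p (1 / z)"
proof -
  have "poly (rev_poly n p) z = (\<Sum>i\<le>n. coeff p (n - i) * z ^ i)"
    by (simp add: rev_poly_def poly_sum poly_monom)
  also have "\<dots> = (\<Sum>i\<le>n. coeff p i * z ^ (n - i))"
    by (rule sum.reindex_bij_witness[of _ "\<lambda>i. n - i" "\<lambda>i. n - i"]) auto
  also have "\<dots> = (\<Sum>i\<le>n. z ^ n * (coeff p i * (1 / z) ^ i))"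
    using assms(2) by (intro sum.cong) (auto simp: power_diff power_one_over)
  also have "\<dots> = z ^ n * poly p (1 / z)"
    using assms(1) unfolding poly_altdef sum_distrib_left
    by (intro sum.mono_neutral_right) (auto simp: coeff_eq_0)
  finally show ?thesis .
qed

text \<open>For the form \<open>B p q = \<integral> w(\<zeta>) p(\<zeta>) q(1/\<zeta>)\<close> the Toeplitz property \<open>flip\<close> is
  \<open>p(\<zeta>) q(1/\<zeta>) = \<zeta>\<^sup>n q(1/\<zeta>) (1/\<zeta>)\<^sup>n p(\<zeta>)\<close>. All assumptions are invariant under exchanging the
  two arguments together with the two families, which yields the second half of each result.\<close>

locale toeplitz_biorthogonal =
  fixes B :: "'a::field poly \<Rightarrow> 'a poly \<Rightarrow> 'a" and \<phi> \<psi> :: "nat \<Rightarrow> 'a poly"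
  assumes add_left: "B (p + p') q = B p q + B p' q"
    and add_right: "B p (q + q') = B p q + B p q'"
    and smult_left: "B (Polynomial.smult c p) q = c * B p q"
    and smult_right: "B p (Polynomial.smult c q) = c * B p q"
    and flip: "degree p \<le> n \<Longrightarrow> degree q \<le> n \<Longrightarrow> B (rev_poly n q) (rev_poly n p) = B p q"
    and biorth: "B (\<phi> m) (\<psi> n) = (if m = n then 1 else 0)"
    and deg: "degree (\<phi> n) = n" "degree (\<psi> n) = n"
    and lead: "lead_coeff (\<psi> n) = lead_coeff (\<phi> n)"
begin

lemma swap: "toeplitz_biorthogonal (\<lambda>p q. B q p) \<psi> \<phi>"
proof
  show "lead_coeff (\<phi> n) = lead_coeff (\<psi> n)" for n by (rule lead[symmetric])
qed (simp_all add: add_left add_right smult_left smult_right flip biorth deg)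

abbreviation \<kappa> where "\<kappa> n \<equiv> lead_coeff (\<phi> n)"

lemma zero_left [simp]: "B 0 q = 0"
  using smult_left[of 0 0 q] by simp

lemma diff_left: "B (p - p') q = B p q - B p' q"
  using add_left[of "p - p'" p' q] by simp

text \<open>The factors zeta and 1/zeta cancel. Formally, \<open>flip\<close> at
  \<open>Suc n\<close> followed by \<open>flip\<close> at \<open>n\<close> removes both factors,
  because a zero constant term shortens the reversal by one.\<close>

lemma shift: "B (pCons 0 p) (pCons 0 q) = B p q"
proof -
  define n where "n = max (degree p) (degree q)"
  have "degree p \<le> n" "degree q \<le> n" by (auto simp: n_def)
  then show ?thesis
    using flip[of "pCons 0 p" "Suc n" "pCons 0 q"] flip[of p n q]
    by (simp add: rev_poly_pCons_0 degree_pCons_le order_trans[OF degree_pCons_le])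
qed

lemma \<kappa>_nz: "\<kappa> n \<noteq> 0"
proof
  assume "\<kappa> n = 0"
  then have "\<phi> n = 0" by simp
  with biorth[of n n] show False by simp
qed

text \<open>Strong induction on the degree: subtracting a multiple of \<open>\<phi> d\<close> kills
  the top coefficient, and \<open>\<phi> d\<close> is orthogonal to \<open>\<psi> n\<close> since d
  < n.\<close>

lemma degree_less_left:
  assumes "degree p < n"
  shows "B p (\<psi> n) = 0"
  using assms
proof (induction "degree p" arbitrary: p rule: less_induct)
  case less
  define d where "d = degree p"
  define q where "q = p - Polynomial.smult (coeff p d / \<kappa> d) (\<phi> d)"
  have "coeff q d = 0" using \<kappa>_nz[of d] by (simp add: q_def deg)
  moreover have dq: "degree q \<le> d"
    unfolding q_def by (intro degree_diff_le) (auto simp: d_def deg intro: order_trans[OF degree_smult_le])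
  ultimately have "q = 0 \<or> degree q < d"
    by (metis eq_zero_or_degree_less)
  then have "B q (\<psi> n) = 0" using less.hyps less.prems by (auto simp: d_def)
  then have "B p (\<psi> n) = coeff p d / \<kappa> d * B (\<phi> d) (\<psi> n)"
    unfolding q_def diff_left smult_left by simp
  then show ?case using less.prems by (simp add: biorth d_def)
qed

lemma degree_le_left:
  assumes "degree p \<le> n"
  shows "B p (\<psi> n) = coeff p n / \<kappa> n"
proof -
  define q where "q = p - Polynomial.smult (coeff p n / \<kappa> n) (\<phi> n)"
  have "coeff q n = 0" using \<kappa>_nz[of n] by (simp add: q_def deg)
  moreover have "degree q \<le> n"
    unfolding q_def using assms
    by (intro degree_diff_le) (auto simp: deg intro: order_trans[OF degree_smult_le])
  ultimately have "q = 0 \<or> degree q < n"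
    by (metis eq_zero_or_degree_less)
  then have "B q (\<psi> n) = 0" using degree_less_left by auto
  then have "B p (\<psi> n) = coeff p n / \<kappa> n * B (\<phi> n) (\<psi> n)"
    unfolding q_def diff_left smult_left by simp
  then show ?thesis by (simp add: biorth)
qed

lemmas degree_less_right = toeplitz_biorthogonal.degree_less_left[OF swap]

lemma degree_le_right: "degree q \<le> n \<Longrightarrow> B (\<phi> n) q = coeff q n / \<kappa> n"
  using toeplitz_biorthogonal.degree_le_left[OF swap] by (simp add: lead)

text \<open>Moves the reversed polynomial out of the left slot, so that orthogonality to
  \<open>\<psi> n\<close> becomes applicable.\<close>

lemma reflect_left:
  assumes "degree q \<le> n"
  shows "B (reflect_poly (\<psi> n)) q = B (rev_poly n q) (\<psi> n)"
proof -
  have "reflect_poly (\<psi> n) = rev_poly n (\<psi> n)"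
    using rev_poly_degree[of "\<psi> n"] by (simp add: deg)
  then show ?thesis
    using flip[of "rev_poly n q" n "\<psi> n"] assms
    by (simp add: degree_rev_poly deg rev_poly_rev_poly)
qed

section \<open>Szego recurrences for the two families\<close>

lemma zero_if_orthogonal:
  assumes "degree S < n" and orth: "\<And>q. degree q < n \<Longrightarrow> B S q = 0"
  shows "S = 0"
proof -
  have "B S (\<psi> (degree S)) = 0" using assms by (intro orth) (simp add: deg)
  then have "lead_coeff S = 0" using \<kappa>_nz by (simp add: degree_le_left)
  then show ?thesis by simp
qed

text \<open>The difference \<open>R\<close> of the two sides has neither a constant term nor a term
  of degree n + 1, so it is z times some \<open>S\<close>. By \<open>shift\<close>, \<open>S\<close>
  inherits orthogonality to all degrees below \<open>n\<close>, and its own degree is below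
  \<open>n\<close>.\<close>

lemma recurrence:
  "Polynomial.smult (\<kappa> n) (\<phi> (Suc n)) =
     Polynomial.smult (\<kappa> (Suc n)) (pCons 0 (\<phi> n))
     + Polynomial.smult (coeff (\<phi> (Suc n)) 0) (reflect_poly (\<psi> n))"
proof -
  define R where "R = Polynomial.smult (\<kappa> n) (\<phi> (Suc n)) -
     Polynomial.smult (\<kappa> (Suc n)) (pCons 0 (\<phi> n))
     - Polynomial.smult (coeff (\<phi> (Suc n)) 0) (reflect_poly (\<psi> n))"
  have "coeff R 0 = 0" using lead[of n] by (simp add: R_def)
  then obtain S where RS: "R = pCons 0 S" by (cases R) auto
  have coeff_R: "coeff R i = 0" if "i \<ge> Suc n" for i
  proof (cases "i = Suc n")
    case True
    have "coeff (\<phi> (Suc n)) (Suc n) = \<kappa> (Suc n)" "coeff (\<phi> n) n = \<kappa> n" by (simp_all add: deg)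
    with True show ?thesis by (simp add: R_def coeff_reflect_poly deg)
  next
    case False
    with that show ?thesis
      by (cases i) (simp_all add: R_def coeff_reflect_poly deg coeff_eq_0)
  qed
  have "S = 0"
  \<comment> \<open>For n = 0 the bound \<open>degree S < n\<close> is unattainable; there the
    vanishing coefficients of \<open>R\<close> suffice.\<close>
  proof (cases n)
    case 0
    have "coeff S i = 0" for i using coeff_R[of "Suc i"] RS 0 by simp
    then show ?thesis by (simp add: poly_eq_iff)
  next
    case (Suc k)
    show ?thesis
    proof (rule zero_if_orthogonal)
      have "degree S \<le> k" using coeff_R RS Suc by (intro degree_le) (metis coeff_pCons_Suc Suc_leI Suc_le_mono)
      then show "degree S < n" using Suc by simp
    next
      fix q :: "'a poly" assume q: "degree q < n"
      then have "degree (pCons 0 q) \<le> n"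
        using degree_pCons_le[of 0 q] by linarith
      \<comment> \<open>The reversal has degree at most k = n - 1, hence is orthogonal to
        \<open>\<psi> n\<close>.\<close>
      moreover have "rev_poly n (pCons 0 q) = rev_poly k q" by (simp add: Suc rev_poly_pCons_0)
      ultimately have "B (reflect_poly (\<psi> n)) (pCons 0 q) = 0"
        using degree_rev_poly[of k q] Suc by (simp add: reflect_left degree_less_left)
      moreover have "B (\<phi> (Suc n)) (pCons 0 q) = 0" "B (\<phi> n) q = 0"
        using \<open>degree (pCons 0 q) \<le> n\<close> q by (simp_all add: degree_less_right)
      ultimately have "B R (pCons 0 q) = 0"
        by (simp add: R_def diff_left smult_left shift del: smult_pCons)
      then show "B S q = 0" by (simp add: RS shift)
    qed
  qed
  then have "R = 0" by (simp add: RS)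
  then show ?thesis by (simp add: R_def algebra_simps)
qed

lemmas recurrence_right = toeplitz_biorthogonal.recurrence[OF swap]

lemma reflect_poly_\<psi>: "reflect_poly (\<psi> n) = rev_poly n (\<psi> n)"
  using rev_poly_degree[of "\<psi> n"] by (simp add: deg)

text \<open>The recurrence of the second family, reversed relative to degree n + 1.\<close>

lemma recurrence_reflected:
  "Polynomial.smult (\<kappa> n) (reflect_poly (\<psi> (Suc n))) =
     Polynomial.smult (\<kappa> (Suc n)) (reflect_poly (\<psi> n))
     + Polynomial.smult (coeff (\<psi> (Suc n)) 0) (pCons 0 (\<phi> n))"
proof -
  have "rev_poly (Suc n) (reflect_poly (\<phi> n)) = pCons 0 (\<phi> n)"
    using rev_poly_degree[of "\<phi> n"] degree_rev_poly[of n "\<phi> n"] rev_poly_rev_poly[of "\<phi> n" n]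
    by (simp add: deg rev_poly_Suc)
  then show ?thesis
    using arg_cong[OF recurrence_right[of n], of "rev_poly (Suc n)"]
    by (simp add: rev_poly_add rev_poly_smult rev_poly_pCons_0 reflect_poly_\<psi> lead
        del: smult_pCons)
qed

text \<open>Pair the recurrence with 1: the left side vanishes by orthogonality, and the reversed
  polynomial contributes 1 / \<open>\<kappa> n\<close> because 1 reverses to z^n. The value is the
  boundary term that appears when the variable is moved past the kernel below.\<close>

lemma shift_one: "\<kappa> (Suc n) * B (pCons 0 (\<phi> n)) 1 = - coeff (\<phi> (Suc n)) 0 / \<kappa> n"
proof -
  have "rev_poly n (1 :: 'a poly) = monom 1 n"
    by (intro poly_eqI) (auto simp: coeff_rev_poly coeff_monom)
  then have "B (reflect_poly (\<psi> n)) 1 = 1 / \<kappa> n"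
    by (simp add: reflect_left degree_le_left degree_monom_eq)
  moreover have "B (\<phi> (Suc n)) 1 = 0" by (simp add: degree_less_right)
  ultimately show ?thesis
    using arg_cong[OF recurrence[of n], of "\<lambda>p. B p 1"]
    by (simp add: add_left smult_left eq_neg_iff_add_eq_0 del: smult_pCons)
qed

lemma shift_one_right: "\<kappa> (Suc n) * B 1 (pCons 0 (\<psi> n)) = - coeff (\<psi> (Suc n)) 0 / \<kappa> n"
  using toeplitz_biorthogonal.shift_one[OF swap] by (simp add: lead)

text \<open>The pairing of z \<open>\<phi> n\<close> with \<open>\<psi> (Suc n)\<close> is computed
  twice: from its top coefficient, and from the recurrence of \<open>\<psi>\<close>.\<close>

lemma \<kappa>_square: "(\<kappa> (Suc n))\<^sup>2 - (\<kappa> n)\<^sup>2 = coeff (\<phi> (Suc n)) 0 * coeff (\<psi> (Suc n)) 0"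
proof -
  obtain s where s: "reflect_poly (\<phi> n) = pCons (\<kappa> n) s"
    by (metis coeff_0_reflect_poly coeff_pCons_0 pCons_cases)
  have ds: "n = 0 \<and> s = 0 \<or> degree s < n"
  proof (cases "s = 0")
    case False
    then have "Suc (degree s) \<le> n"
      using s degree_rev_poly[of n "\<phi> n"] rev_poly_degree[of "\<phi> n"] by (simp add: deg)
    then show ?thesis by simp
  qed (use \<kappa>_nz in auto)
  \<comment> \<open>Only the constant part of the reversed polynomial pairs nontrivially with z
    \<open>\<phi> n\<close>; the part z \<open>s\<close> reduces by \<open>shift\<close> to
    \<open>\<phi> n\<close> against the lower degree polynomial \<open>s\<close>.\<close>
  have "reflect_poly (\<phi> n) = Polynomial.smult (\<kappa> n) 1 + pCons 0 s" by (simp add: s)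
  moreover have "B (\<phi> n) s = 0"
    using ds degree_less_right[of s n] smult_right[of "\<phi> n" 0 0] by auto
  ultimately have 1: "B (pCons 0 (\<phi> n)) (reflect_poly (\<phi> n)) = \<kappa> n * B (pCons 0 (\<phi> n)) 1"
    by (simp only: add_right smult_right shift) simp
  have 2: "\<kappa> n * B (pCons 0 (\<phi> n)) (\<psi> (Suc n)) =
      \<kappa> (Suc n) + coeff (\<psi> (Suc n)) 0 * (\<kappa> n * B (pCons 0 (\<phi> n)) 1)"
    using arg_cong[OF recurrence_right[of n], of "B (pCons 0 (\<phi> n))"]
    by (simp add: add_right smult_right shift biorth lead 1 del: smult_pCons)
  have "B (pCons 0 (\<phi> n)) (\<psi> (Suc n)) = \<kappa> n / \<kappa> (Suc n)"
    using \<kappa>_nz[of n] by (simp add: degree_le_left deg)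
  then have "\<kappa> n * \<kappa> n = \<kappa> (Suc n) * \<kappa> (Suc n)
      + coeff (\<psi> (Suc n)) 0 * (\<kappa> n * (\<kappa> (Suc n) * B (pCons 0 (\<phi> n)) 1))"
    using 2 \<kappa>_nz[of "Suc n"] by (simp add: field_simps)
  then show ?thesis
    using \<kappa>_nz[of n] unfolding shift_one by (simp add: field_simps power2_eq_square)
qed

end

section \<open>The bi-orthogonal system on the unit circle\<close>

text \<open>With zeta = exp(2 pi i x), the measure d zeta / (2 pi i zeta) is dx.\<close>

lemma circle_int_eq: "circle_int g = integral {0..1} (\<lambda>x. g (circlepath 0 1 x))"
proof -
  have "g (circlepath 0 1 x) / (2 * of_real pi * \<i> * circlepath 0 1 x) *
      vector_derivative (circlepath 0 1) (at x) = g (circlepath 0 1 x)" for x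
    by (simp only: vector_derivative_circlepath) (simp add: circlepath)
  then show ?thesis by (simp add: circle_int_def contour_integral_integral)
qed

lemma circlepath_in_sphere: "circlepath 0 1 x \<in> sphere 0 1"
  by (simp add: circlepath norm_exp_eq_Re)

lemma circle_int_cong:
  assumes "\<And>\<zeta>. \<zeta> \<in> sphere 0 1 \<Longrightarrow> g \<zeta> = h \<zeta>"
  shows "circle_int g = circle_int h"
  using assms[OF circlepath_in_sphere] by (simp add: circle_int_eq)

lemma cnj_on_sphere: "\<zeta> \<in> sphere 0 1 \<Longrightarrow> cnj \<zeta> = 1 / \<zeta>"
  by (auto simp: divide_conv_cnj)

lemma sphere_nonzero: "\<zeta> \<in> sphere 0 (1::real) \<Longrightarrow> (\<zeta>::complex) \<noteq> 0"
  by auto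

locale circle_weight =
  fixes w :: "complex \<Rightarrow> complex"
  assumes w_integrable: "(\<lambda>x. w (circlepath 0 1 x)) absolutely_integrable_on {0..1}"
begin

definition mean :: "(complex \<Rightarrow> complex) \<Rightarrow> complex" where
  "mean h = circle_int (\<lambda>\<zeta>. w \<zeta> * h \<zeta>)"

text \<open>The weight may be singular on the circle, so only its absolute integrability is
  available; a continuous factor is bounded and measurable and preserves it.\<close>

lemma integrable:
  assumes "continuous_on (sphere 0 1) h"
  shows "(\<lambda>x. w (circlepath 0 1 x) * h (circlepath 0 1 x)) integrable_on {0..1}"
proof -
  have cont: "continuous_on {0..1} (\<lambda>x. h (circlepath 0 1 x))"
    by (rule continuous_on_compose2[OF assms])
      (auto simp: circlepath norm_exp_eq_Re intro!: continuous_intros)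
  have "(\<lambda>x. h (circlepath 0 1 x) * w (circlepath 0 1 x)) absolutely_integrable_on {0..1}"
  proof (rule absolutely_integrable_bounded_measurable_product[where h = "(*)", OF _ _ _ _ w_integrable])
    show "bilinear ((*) :: complex \<Rightarrow> complex \<Rightarrow> complex)"
      using bilinear_conv_bounded_bilinear bounded_bilinear_mult by blast
    show "(\<lambda>x. h (circlepath 0 1 x)) \<in> borel_measurable (lebesgue_on {0..1})"
      by (rule continuous_imp_measurable_on_sets_lebesgue[OF cont]) auto
    show "bounded ((\<lambda>x. h (circlepath 0 1 x)) ` {0..1})"
      by (intro compact_imp_bounded compact_continuous_image cont) auto
  qed auto
  then show ?thesis
    by (simp add: mult.commute set_lebesgue_integral_eq_integral(1))
qed

lemma mean_cong: "(\<And>\<zeta>. \<zeta> \<in> sphere 0 1 \<Longrightarrow> g \<zeta> = h \<zeta>) \<Longrightarrow> mean g = mean h"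
  unfolding mean_def by (intro circle_int_cong) simp

lemma mean_add:
  "continuous_on (sphere 0 1) g \<Longrightarrow> continuous_on (sphere 0 1) h \<Longrightarrow>
    mean (\<lambda>\<zeta>. g \<zeta> + h \<zeta>) = mean g + mean h"
  by (simp add: mean_def circle_int_eq distrib_left integral_add integrable)

lemma mean_cmult: "mean (\<lambda>\<zeta>. c * h \<zeta>) = c * mean h"
  using integral_mult_right[of "{0..1}" c "\<lambda>x. w (circlepath 0 1 x) * h (circlepath 0 1 x)"]
  by (simp add: mean_def circle_int_eq mult_ac)

text \<open>On the circle \<open>cnj \<zeta>\<close> is 1/zeta, which makes this the Toeplitz form
  of the abstract locale.\<close>

definition form :: "complex poly \<Rightarrow> complex poly \<Rightarrow> complex" where
  "form p q = mean (\<lambda>\<zeta>. poly p \<zeta> * poly q (cnj \<zeta>))"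

lemma form_add_left: "form (p + p') q = form p q + form p' q"
  unfolding form_def
  by (subst mean_add[symmetric]) (auto simp: distrib_right intro!: continuous_intros)

lemma form_add_right: "form p (q + q') = form p q + form p q'"
  unfolding form_def
  by (subst mean_add[symmetric]) (auto simp: distrib_left intro!: continuous_intros)

lemma form_smult_left: "form (Polynomial.smult c p) q = c * form p q"
  unfolding form_def by (subst mean_cmult[symmetric]) (simp add: mult_ac)

lemma form_smult_right: "form p (Polynomial.smult c q) = c * form p q"
  unfolding form_def by (subst mean_cmult[symmetric]) (simp add: mult_ac)

lemma form_flip:
  assumes "degree p \<le> n" "degree q \<le> n"
  shows "form (rev_poly n q) (rev_poly n p) = form p q"
  unfolding form_def
proof (rule mean_cong)
  fix \<zeta> :: complex assume "\<zeta> \<in> sphere 0 1"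
  then have "\<zeta> \<noteq> 0" "cnj \<zeta> = 1 / \<zeta>" using sphere_nonzero cnj_on_sphere by auto
  then show "poly (rev_poly n q) \<zeta> * poly (rev_poly n p) (cnj \<zeta>) = poly p \<zeta> * poly q (cnj \<zeta>)"
    using assms by (simp add: poly_rev_poly power_one_over)
qed

lemma toeplitz_elem_eq_mean: "toeplitz_elem w k = mean (\<lambda>\<zeta>. \<zeta> powi (- k))"
  by (simp add: toeplitz_elem_def mean_def)

lemma toeplitz_elem_0: "toeplitz_elem w 0 = form 1 1"
  by (simp add: toeplitz_elem_eq_mean form_def)

lemma toeplitz_elem_minus_1: "toeplitz_elem w (-1) = form [:0, 1:] 1"
  by (simp add: toeplitz_elem_eq_mean form_def)

end

locale circle_system = circle_weight +
  fixes \<phi> \<phi>b :: "nat \<Rightarrow> complex poly"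
  assumes biorthogonal: "biorthogonal_system w \<phi> \<phi>b"

sublocale circle_system \<subseteq> toeplitz_biorthogonal form \<phi> \<phi>b
proof
  show "form (\<phi> m) (\<phi>b n) = (if m = n then 1 else 0)" for m n
    using biorthogonal by (simp add: biorthogonal_system_def form_def mean_def mult.assoc)
  show "degree (\<phi> n) = n" "degree (\<phi>b n) = n" "lead_coeff (\<phi>b n) = lead_coeff (\<phi> n)" for n
    using biorthogonal unfolding biorthogonal_system_def by metis+
qed (rule form_add_left form_add_right form_smult_left form_smult_right form_flip; assumption?)+

context circle_system
begin

lemma \<phi>_0: "\<phi> 0 = [:\<kappa> 0:]" and \<phi>b_0: "\<phi>b 0 = [:\<kappa> 0:]"
  using deg[of 0] lead[of 0] by (auto elim!: degree_eq_zeroE)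

lemma norm_0: "(\<kappa> 0)\<^sup>2 * toeplitz_elem w 0 = 1"
proof -
  have "\<phi> 0 = Polynomial.smult (\<kappa> 0) 1" "\<phi>b 0 = Polynomial.smult (\<kappa> 0) 1"
    using \<phi>_0 \<phi>b_0 by (simp_all add: one_pCons)
  then have "form (\<phi> 0) (\<phi>b 0) = (\<kappa> 0)\<^sup>2 * form 1 1"
    by (metis form_smult_left form_smult_right mult.assoc power2_eq_square)
  then show ?thesis using biorth[of 0 0] by (simp add: toeplitz_elem_0)
qed

text \<open>Orthogonality of \<open>\<phi> 1\<close> to 1, written in Toeplitz elements; the source
  of w_{-1} in the initial values.\<close>

lemma coeff_\<phi>_1: "coeff (\<phi> 1) 0 * toeplitz_elem w 0 = - \<kappa> 1 * toeplitz_elem w (-1)"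
proof -
  have "\<phi> 1 = Polynomial.smult (coeff (\<phi> 1) 0) 1 + Polynomial.smult (\<kappa> 1) [:0, 1:]"
    using deg(1)[of 1] by (intro poly_eqI) (auto simp: coeff_pCons coeff_eq_0 split: nat.split)
  moreover have "form (\<phi> 1) 1 = 0" by (simp add: degree_less_right)
  ultimately have "coeff (\<phi> 1) 0 * form 1 1 + \<kappa> 1 * form [:0, 1:] 1 = 0"
    by (metis form_add_left form_smult_left)
  then show ?thesis
    by (simp add: toeplitz_elem_0 toeplitz_elem_minus_1 eq_neg_iff_add_eq_0)
qed

section \<open>Recurrences of the functions of the second kind\<close>

definition kernel_poly :: "complex \<Rightarrow> nat \<Rightarrow> complex poly" where
  "kernel_poly z n = [:z, 1:] * (\<Sum>i<n. monom (z ^ (n - Suc i)) i)"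

text \<open>By the geometric sum the pole at z cancels; this polynomial is the correction for
  replacing zeta^n by z^n next to the kernel.\<close>

lemma poly_kernel_poly:
  "\<zeta> \<noteq> z \<Longrightarrow> poly (kernel_poly z n) \<zeta> = (\<zeta> + z) / (\<zeta> - z) * (\<zeta> ^ n - z ^ n)"
  by (simp add: kernel_poly_def poly_sum poly_monom power_diff_sumr2 mult_ac add.commute distrib_right)

lemma coeff_kernel_sum: "coeff (\<Sum>i<n. monom (z ^ (n - Suc i)) i) k = (if k < n then z ^ (n - Suc k) else (0::complex))"
  by (simp add: coeff_sum coeff_monom)

lemma coeff_kernel_poly:
  "coeff (kernel_poly z n) k = z * (if k < n then z ^ (n - Suc k) else 0)
    + (case k of 0 \<Rightarrow> 0 | Suc j \<Rightarrow> if j < n then z ^ (n - Suc j) else 0)"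
  by (cases k) (simp_all add: kernel_poly_def coeff_kernel_sum)

lemma kernel_poly_coeffs:
  assumes "n > 0"
  shows "degree (kernel_poly z n) \<le> n" "coeff (kernel_poly z n) n = 1"
    "coeff (kernel_poly z n) 0 = z ^ n"
  using assms
  by (auto intro!: degree_le simp: coeff_kernel_poly gr0_conv_Suc split: nat.split)

context
  fixes z :: complex
  assumes z: "norm z \<noteq> 1" "z \<noteq> 0"
begin

abbreviation "ker \<zeta> \<equiv> (\<zeta> + z) / (\<zeta> - z)"

lemma off_sphere: "\<zeta> \<in> sphere 0 1 \<Longrightarrow> \<zeta> \<noteq> z"
  using z by auto

lemma continuous_ker [continuous_intros]: "continuous_on (sphere 0 1) ker"
  using off_sphere by (intro continuous_intros) auto

definition E :: "complex poly \<Rightarrow> complex" where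
  "E p = mean (\<lambda>\<zeta>. ker \<zeta> * poly p \<zeta>)"

definition Eb :: "complex poly \<Rightarrow> complex" where
  "Eb q = mean (\<lambda>\<zeta>. ker \<zeta> * poly q (cnj \<zeta>))"

lemma E_add: "E (p + q) = E p + E q"
  unfolding E_def using z(1) by (subst mean_add[symmetric]) (auto simp: distrib_left intro!: continuous_intros continuous_ker)

lemma E_smult: "E (Polynomial.smult c p) = c * E p"
  unfolding E_def by (subst mean_cmult[symmetric]) (simp add: mult_ac)

lemma Eb_add: "Eb (p + q) = Eb p + Eb q"
  unfolding Eb_def using z(1) by (subst mean_add[symmetric]) (auto simp: distrib_left intro!: continuous_intros continuous_ker)

lemma Eb_smult: "Eb (Polynomial.smult c p) = c * Eb p"
  unfolding Eb_def by (subst mean_cmult[symmetric]) (simp add: mult_ac)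

text \<open>Kernel identity: zeta ker = z ker + (zeta + z).\<close>

lemma E_pCons: "E (pCons 0 p) = z * E p + (form (pCons 0 p) 1 + z * form p 1)"
proof -
  have "E (pCons 0 p) = mean (\<lambda>\<zeta>. z * (ker \<zeta> * poly p \<zeta>) +
      (poly (pCons 0 p) \<zeta> * poly 1 (cnj \<zeta>) + z * (poly p \<zeta> * poly 1 (cnj \<zeta>))))"
    unfolding E_def using off_sphere by (intro mean_cong) (simp add: field_simps)
  also have "\<dots> = z * E p + (form (pCons 0 p) 1 + z * form p 1)"
    unfolding E_def form_def
    by (subst mean_add, (intro continuous_intros continuous_ker)+)+ (simp only: mean_cmult)
  finally show ?thesis .
qed

text \<open>Kernel identity divided by zeta: ker = z ker / zeta + (1 + z / zeta).\<close>

lemma Eb_pCons: "z * Eb (pCons 0 q) = Eb q - (form 1 q + z * form 1 (pCons 0 q))"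
proof -
  have "Eb q = mean (\<lambda>\<zeta>. z * (ker \<zeta> * poly (pCons 0 q) (cnj \<zeta>)) +
      (poly 1 \<zeta> * poly q (cnj \<zeta>) + z * (poly 1 \<zeta> * poly (pCons 0 q) (cnj \<zeta>))))"
    unfolding Eb_def using off_sphere sphere_nonzero
    by (intro mean_cong) (simp add: cnj_on_sphere divide_simps, simp add: algebra_simps)
  also have "\<dots> = z * Eb (pCons 0 q) + (form 1 q + z * form 1 (pCons 0 q))"
    unfolding Eb_def form_def
    by (subst mean_add, (intro continuous_intros continuous_ker)+)+ (simp only: mean_cmult)
  finally show ?thesis by simp
qed

text \<open>Split zeta^n = z^n + (zeta^n - z^n); the second part times the kernel is
  \<open>kernel_poly z n\<close>.\<close>

lemma E_rev_poly:
  assumes "degree q \<le> n"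
  shows "E (rev_poly n q) = z ^ n * Eb q + form (kernel_poly z n) q"
proof -
  have "E (rev_poly n q) = mean (\<lambda>\<zeta>. z ^ n * (ker \<zeta> * poly q (cnj \<zeta>)) +
      poly (kernel_poly z n) \<zeta> * poly q (cnj \<zeta>))"
    unfolding E_def
  proof (rule mean_cong)
    fix \<zeta> :: complex assume \<zeta>: "\<zeta> \<in> sphere 0 1"
    have rev: "poly (rev_poly n q) \<zeta> = \<zeta> ^ n * poly q (cnj \<zeta>)"
      using \<zeta> sphere_nonzero[OF \<zeta>] assms by (simp add: poly_rev_poly cnj_on_sphere)
    show "ker \<zeta> * poly (rev_poly n q) \<zeta> =
        z ^ n * (ker \<zeta> * poly q (cnj \<zeta>)) + poly (kernel_poly z n) \<zeta> * poly q (cnj \<zeta>)"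
      unfolding rev poly_kernel_poly[OF off_sphere[OF \<zeta>]] by (simp only: right_diff_distrib left_diff_distrib mult_ac) simp
  qed
  also have "\<dots> = z ^ n * Eb q + form (kernel_poly z n) q"
    unfolding Eb_def form_def
    by (subst mean_add, (intro continuous_intros continuous_ker)+) (simp only: mean_cmult)
  finally show ?thesis .
qed

lemma Eb_rev_poly:
  assumes "degree p \<le> n"
  shows "z ^ n * Eb (rev_poly n p) = E p - form p (rev_poly n (kernel_poly z n))"
proof -
  have "E p = mean (\<lambda>\<zeta>. z ^ n * (ker \<zeta> * poly (rev_poly n p) (cnj \<zeta>)) +
      poly p \<zeta> * poly (rev_poly n (kernel_poly z n)) (cnj \<zeta>))"
    unfolding E_def
  proof (rule mean_cong)
    fix \<zeta> :: complex assume \<zeta>: "\<zeta> \<in> sphere 0 1"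
    have "degree (kernel_poly z n) \<le> n"
      using kernel_poly_coeffs(1)[of n z] by (cases "n = 0") (auto simp: kernel_poly_def)
    then have rev: "poly (rev_poly n p) (cnj \<zeta>) = (1 / \<zeta>) ^ n * poly p \<zeta>"
      "poly (rev_poly n (kernel_poly z n)) (cnj \<zeta>) = (1 / \<zeta>) ^ n * poly (kernel_poly z n) \<zeta>"
      using \<zeta> sphere_nonzero[OF \<zeta>] assms by (simp_all add: poly_rev_poly cnj_on_sphere)
    show "ker \<zeta> * poly p \<zeta> =
        z ^ n * (ker \<zeta> * poly (rev_poly n p) (cnj \<zeta>)) +
        poly p \<zeta> * poly (rev_poly n (kernel_poly z n)) (cnj \<zeta>)"
    proof -
      have "k * a = c * (k * (b' * a)) + a * (b' * (k * (b - c)))" if "b' * b = 1" for k a b b' c :: complex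
        using arg_cong[OF that, of "\<lambda>x. k * a * x"] by (simp add: right_diff_distrib mult_ac)
      moreover have "(1 / \<zeta>) ^ n * \<zeta> ^ n = 1"
        using sphere_nonzero[OF \<zeta>] by (simp add: power_one_over)
      ultimately show ?thesis
        unfolding rev poly_kernel_poly[OF off_sphere[OF \<zeta>]] by blast
    qed
  qed
  also have "\<dots> = z ^ n * Eb (rev_poly n p) + form p (rev_poly n (kernel_poly z n))"
    unfolding Eb_def form_def
    by (subst mean_add, (intro continuous_intros continuous_ker)+) (simp only: mean_cmult)
  finally show ?thesis by simp
qed

lemma mean_caratheodory: "mean ker = caratheodory w z"
  unfolding mean_def caratheodory_def by (intro circle_int_cong) simp

text \<open>The exceptional summand at n = 0 is kappa_0 w_0, which the normalisation
  \<open>norm_0\<close> turns into 1 / kappa_0.\<close>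

lemma epsilon_eq: "epsilon w \<phi> n z = E (\<phi> n) + (if n = 0 then 1 / \<kappa> 0 else 0)"
proof (cases "n = 0")
  case True
  have "E (\<phi> 0) = \<kappa> 0 * caratheodory w z"
    unfolding E_def mean_caratheodory[symmetric] mean_cmult[symmetric]
    by (subst \<phi>_0, rule mean_cong) simp
  then show ?thesis
    using True norm_0 \<kappa>_nz[of 0] by (simp add: epsilon_def field_simps power2_eq_square)
qed (simp add: epsilon_def E_def mean_def mult_ac)

lemma epsilon_star_eq:
  "epsilon_star w \<phi>b n z = - (z ^ n * Eb (\<phi>b n)) + (if n = 0 then 1 / \<kappa> 0 else 0)"
proof (cases "n = 0")
  case True
  have "Eb (\<phi>b 0) = \<kappa> 0 * caratheodory w z"
    unfolding Eb_def mean_caratheodory[symmetric] mean_cmult[symmetric]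
    by (subst \<phi>b_0, rule mean_cong) simp
  then show ?thesis
    using True norm_0 \<kappa>_nz[of 0] lead[of 0]
    by (simp add: epsilon_star_def field_simps power2_eq_square)
qed (simp add: epsilon_star_def Eb_def mean_def mult_ac)

lemma form_1_right: "form (\<phi> n) 1 = (if n = 0 then 1 / \<kappa> 0 else 0)"
  using degree_le_right[of 1 n] by simp

lemma form_1_left: "form 1 (\<phi>b n) = (if n = 0 then 1 / \<kappa> 0 else 0)"
  using degree_le_left[of 1 n] by simp

text \<open>\<open>kernel_poly z n\<close> is monic of degree \<open>n\<close> for n > 0, but it is
  the empty sum 0 for n = 0.\<close>

lemma form_kernel: "form (kernel_poly z n) (\<phi>b n) = (if n = 0 then 0 else 1 / \<kappa> n)"
  using kernel_poly_coeffs[of n z] by (simp add: degree_le_left) (simp add: kernel_poly_def)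

lemma form_kernel_right:
  "form (\<phi> n) (rev_poly n (kernel_poly z n)) = (if n = 0 then 0 else z ^ n / \<kappa> n)"
  using kernel_poly_coeffs(3)[of n z]
  by (simp add: degree_le_right degree_rev_poly coeff_rev_poly) (simp add: kernel_poly_def)

text \<open>Apply \<open>E\<close> to the polynomial recurrence. For n > 0 the boundary term of
  \<open>shift_one\<close> cancels the one of the kernel; for n = 0 the kernel term is absent and
  what remains are the exceptional summands of epsilon_0 and epsilon_0^*.\<close>

lemma epsilon_Suc:
  "\<kappa> n * epsilon w \<phi> (Suc n) z =
    \<kappa> (Suc n) * z * epsilon w \<phi> n z - coeff (\<phi> (Suc n)) 0 * epsilon_star w \<phi>b n z"
proof -
  have "\<kappa> n * E (\<phi> (Suc n)) = \<kappa> (Suc n) * (z * E (\<phi> n) + z * form (\<phi> n) 1)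
      + \<kappa> (Suc n) * form (pCons 0 (\<phi> n)) 1
      + coeff (\<phi> (Suc n)) 0 * (z ^ n * Eb (\<phi>b n) + form (kernel_poly z n) (\<phi>b n))"
    using arg_cong[OF recurrence[of n], of E]
    by (simp add: E_add E_smult E_pCons reflect_poly_\<psi> E_rev_poly deg algebra_simps del: smult_pCons)
  then show ?thesis
    unfolding shift_one form_1_right form_kernel epsilon_eq epsilon_star_eq
    by (cases n) (simp_all add: algebra_simps)
qed

lemma epsilon_star_Suc:
  "\<kappa> n * epsilon_star w \<phi>b (Suc n) z =
    \<kappa> (Suc n) * epsilon_star w \<phi>b n z - coeff (\<phi>b (Suc n)) 0 * (z * epsilon w \<phi> n z)"
proof -
  have "reflect_poly (\<phi> n) = rev_poly n (\<phi> n)"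
    using rev_poly_degree[of "\<phi> n"] by (simp add: deg)
  then have "\<kappa> n * Eb (\<phi>b (Suc n)) =
      \<kappa> (Suc n) * Eb (pCons 0 (\<phi>b n)) + coeff (\<phi>b (Suc n)) 0 * Eb (rev_poly n (\<phi> n))"
    using arg_cong[OF recurrence_right[of n], of Eb]
    by (simp add: Eb_add Eb_smult lead del: smult_pCons)
  then have "z ^ Suc n * (\<kappa> n * Eb (\<phi>b (Suc n))) =
      \<kappa> (Suc n) * (z ^ n * (z * Eb (pCons 0 (\<phi>b n))))
      + coeff (\<phi>b (Suc n)) 0 * (z * (z ^ n * Eb (rev_poly n (\<phi> n))))"
    by (simp add: algebra_simps)
  also have "\<dots> = \<kappa> (Suc n) * (z ^ n * (Eb (\<phi>b n) - form 1 (\<phi>b n)))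
      - z ^ Suc n * (\<kappa> (Suc n) * form 1 (pCons 0 (\<phi>b n)))
      + coeff (\<phi>b (Suc n)) 0 * (z * (E (\<phi> n) - form (\<phi> n) (rev_poly n (kernel_poly z n))))"
    by (simp add: Eb_pCons Eb_rev_poly deg) (simp add: algebra_simps)
  finally show ?thesis
    unfolding shift_one_right form_1_left form_kernel_right epsilon_eq epsilon_star_eq
    by (cases n) (simp_all add: algebra_simps)
qed

text \<open>Up to the factor -1/w this is det Y_n. One recurrence step multiplies it by z, by
  \<open>\<kappa>_square\<close>; at n = 0 the Caratheodory function cancels and
  \<open>norm_0\<close> gives 2.\<close>

lemma casoratian:
  "poly (\<phi> n) z * epsilon_star w \<phi>b n z + poly (reflect_poly (\<phi>b n)) z * epsilon w \<phi> n z = 2 * z ^ n"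
proof (induction n)
  case 0
  have "poly (\<phi> 0) z = \<kappa> 0" "poly (reflect_poly (\<phi>b 0)) z = \<kappa> 0"
    by (subst \<phi>_0, simp) (subst \<phi>b_0, simp)
  moreover have "epsilon w \<phi> 0 z + epsilon_star w \<phi>b 0 z = 2 * (\<kappa> 0 * toeplitz_elem w 0)"
    using lead[of 0] by (simp add: epsilon_def epsilon_star_def algebra_simps)
  ultimately have "poly (\<phi> 0) z * epsilon_star w \<phi>b 0 z + poly (reflect_poly (\<phi>b 0)) z * epsilon w \<phi> 0 z
      = 2 * ((\<kappa> 0)\<^sup>2 * toeplitz_elem w 0)"
    by (simp add: power2_eq_square distrib_left[symmetric] add.commute)
  then show ?case by (simp add: norm_0)
next
  case (Suc n)
  let ?c = "coeff (\<phi> (Suc n)) 0" and ?d = "coeff (\<phi>b (Suc n)) 0"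
  let ?f = "poly (\<phi> n) z" and ?g = "poly (reflect_poly (\<phi>b n)) z"
  let ?e = "epsilon w \<phi> n z" and ?s = "epsilon_star w \<phi>b n z"
  have f: "\<kappa> n * poly (\<phi> (Suc n)) z = \<kappa> (Suc n) * z * ?f + ?c * ?g"
    using arg_cong[OF recurrence[of n], of "\<lambda>p. poly p z"] by (simp add: mult_ac)
  have g: "\<kappa> n * poly (reflect_poly (\<phi>b (Suc n))) z = \<kappa> (Suc n) * ?g + ?d * (z * ?f)"
    using arg_cong[OF recurrence_reflected[of n], of "\<lambda>p. poly p z"] by (simp add: mult_ac)
  have "(\<kappa> n)\<^sup>2 * (poly (\<phi> (Suc n)) z * epsilon_star w \<phi>b (Suc n) z
      + poly (reflect_poly (\<phi>b (Suc n))) z * epsilon w \<phi> (Suc n) z) =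
      (\<kappa> n * poly (\<phi> (Suc n)) z) * (\<kappa> n * epsilon_star w \<phi>b (Suc n) z)
      + (\<kappa> n * poly (reflect_poly (\<phi>b (Suc n))) z) * (\<kappa> n * epsilon w \<phi> (Suc n) z)"
    by (simp add: power2_eq_square algebra_simps)
  also have "\<dots> = z * ((\<kappa> (Suc n))\<^sup>2 - ?c * ?d) * (?f * ?s + ?g * ?e)"
    unfolding f g epsilon_Suc epsilon_star_Suc by (simp add: power2_eq_square algebra_simps)
  also have "(\<kappa> (Suc n))\<^sup>2 - ?c * ?d = (\<kappa> n)\<^sup>2"
    using \<kappa>_square[of n] by (simp add: algebra_simps)
  finally show ?case using \<kappa>_nz[of n] by (simp add: Suc.IH)
qed

end
end

section \<open>Compatibility of the spectral and the recurrence structure\<close>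

lemma index_mult_mat_2:
  fixes A B :: "complex mat"
  assumes "dim_row A = 2" "dim_col A = 2" "dim_row B = 2" "dim_col B = 2" "i < 2" "j < 2"
  shows "(A * B) $$ (i, j) = A $$ (i, 0) * B $$ (0, j) + A $$ (i, 1) * B $$ (1, j)"
  using assms by (simp add: scalar_prod_def numeral_2_eq_2)

locale spectral_system = circle_system +
  fixes W V U W1 :: "complex poly" and D :: "complex set"
    and \<Theta> \<Omega> :: "nat \<Rightarrow> complex poly" and \<Theta>s \<Omega>s :: "nat \<Rightarrow> complex \<Rightarrow> complex"
  assumes W_eq: "W = pCons 0 W1"
    and W_nz: "W \<noteq> 0"
    and weight: "semiclassical_weight W V D w"
    and F_ode: "\<And>z. norm z \<noteq> 1 \<Longrightarrow>
        \<exists>F'. (caratheodory w has_field_derivative F') (at z) \<and>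
             poly W z * F' = 2 * poly V z * caratheodory w z + poly U z"
    and Y_ode: "\<And>n z i j. z \<in> D \<Longrightarrow> norm z \<noteq> 1 \<Longrightarrow> i < 2 \<Longrightarrow> j < 2 \<Longrightarrow>
        ((\<lambda>z. Y_mat w \<phi> \<phi>b n z $$ (i, j)) has_field_derivative
          (A_mat W V \<phi> \<phi>b \<Theta> \<Omega> \<Theta>s \<Omega>s n z * Y_mat w \<phi> \<phi>b n z) $$ (i, j)) (at z)"
    and \<phi>_0_nz: "\<And>n. coeff (\<phi> n) 0 \<noteq> 0"
begin

text \<open>The region where the differential equation and the recurrence hold together. As
  \<open>D\<close> contains no root of \<open>W\<close>, it also excludes 0.\<close>

definition S where "S = D - sphere 0 1"

lemma open_S: "open S"
  using weight by (auto simp: S_def semiclassical_weight_def intro!: open_Diff)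

lemma S_D:
  assumes "z \<in> S"
  shows "z \<in> D" "norm z \<noteq> 1" "z \<noteq> 0" "poly W z \<noteq> 0" "w z \<noteq> 0"
    "(w has_field_derivative 2 * poly V z / poly W z * w z) (at z)"
  using assms weight by (auto simp: S_def semiclassical_weight_def W_eq)

text \<open>\<open>W\<close> has finitely many roots, so the open set \<open>D\<close> meets the
  circle; being open, it is not contained in the null set \<open>sphere 0 1\<close>, and a nonempty
  open set is infinite. Polynomial identities therefore need checking on \<open>S\<close>
  only.\<close>

lemma infinite_S: "infinite S"
proof -
  have "infinite (sphere (0::complex) 1)"
    using uncountable_infinite connected_uncountable[of "sphere (0::complex) 1" 1 "-1"] by (auto simp: connected_sphere)
  moreover have "finite {z. poly W z = 0}" using W_nz by (rule poly_roots_finite)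
  ultimately obtain x where "x \<in> sphere 0 1" "poly W x \<noteq> 0"
    by (metis (mono_tags, lifting) finite_subset mem_Collect_eq subsetI)
  then have x: "x \<in> D" "open D" using weight by (auto simp: semiclassical_weight_def)
  have "\<not> D \<subseteq> sphere 0 1"
    using open_not_negligible[OF x(2)] x(1) negligible_subset negligible_sphere by blast
  then have "S \<noteq> {}" by (auto simp: S_def)
  then show ?thesis using open_S finite_imp_not_open by blast
qed

lemma poly_eq_on_S:
  assumes "\<And>z. z \<in> S \<Longrightarrow> poly p z = poly q z"
  shows "p = q"
proof (rule ccontr)
  assume "p \<noteq> q"
  then have "finite {z. poly (p - q) z = 0}" by (intro poly_roots_finite) simp
  moreover have "S \<subseteq> {z. poly (p - q) z = 0}" using assms by auto
  ultimately show False using infinite_S finite_subset by blast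
qed

abbreviation "k n \<equiv> \<kappa> (Suc n) / \<kappa> n"
abbreviation "p n \<equiv> coeff (\<phi> (Suc n)) 0 / \<kappa> n"
abbreviation "q n \<equiv> coeff (\<phi>b (Suc n)) 0 / \<kappa> n"

text \<open>The entries of \<open>W A\<^sub>n\<close>; only the first row consists of polynomials a priori.\<close>

definition a where "a n = Polynomial.smult (k n) (pCons 0 (\<Theta> n)) - \<Omega> n - V"
definition b where "b n = Polynomial.smult (p n) (\<Theta> n)"
definition c where "c n z = - (q n * z * \<Theta>s n z)"
definition d where "d n z = \<Omega>s n z - poly V z - k n * \<Theta>s n z"

text \<open>\<open>X n j\<close> and \<open>Y n j\<close> are the first and the second row of column \<open>j\<close> of \<open>Y\<^sub>n\<close>.\<close>

definition X where "X n j z = Y_mat w \<phi> \<phi>b n z $$ (0, j)"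
definition Y where "Y n j z = Y_mat w \<phi> \<phi>b n z $$ (1, j)"

lemma X_simps: "X n 0 z = poly (\<phi> n) z" "X n 1 z = epsilon w \<phi> n z / w z"
  and Y_simps: "Y n 0 z = poly (reflect_poly (\<phi>b n)) z" "Y n 1 z = - epsilon_star w \<phi>b n z / w z"
  by (simp_all add: X_def Y_def Y_mat_def mat_of_rows_list_def)

text \<open>Says that the recurrence matrix with rows (k z, p) and (q z, k) has determinant
  z.\<close>

lemma kp_det: "k n * k n - p n * q n = 1"
  using \<kappa>_square[of n] \<kappa>_nz[of n] by (simp add: field_simps power2_eq_square)

lemma XY_ode:
  assumes "z \<in> S" "j < 2"
  shows "(X n j has_field_derivative (poly (a n) z * X n j z + poly (b n) z * Y n j z) / poly W z) (at z)"
    and "(Y n j has_field_derivative (c n z * X n j z + d n z * Y n j z) / poly W z) (at z)"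
proof -
  note dims = A_mat_def Y_mat_def mat_of_rows_list_def Let_def
  have 1: "(A_mat W V \<phi> \<phi>b \<Theta> \<Omega> \<Theta>s \<Omega>s n z * Y_mat w \<phi> \<phi>b n z) $$ (0, j) =
      (poly (a n) z * X n j z + poly (b n) z * Y n j z) / poly W z"
    unfolding X_def Y_def using assms(2)
    by (subst index_mult_mat_2) (auto simp: dims a_def b_def poly_0_coeff_0 algebra_simps add_divide_distrib diff_divide_distrib)
  have 2: "(A_mat W V \<phi> \<phi>b \<Theta> \<Omega> \<Theta>s \<Omega>s n z * Y_mat w \<phi> \<phi>b n z) $$ (1, j) =
      (c n z * X n j z + d n z * Y n j z) / poly W z"
    unfolding X_def Y_def using assms(2)
    by (subst index_mult_mat_2) (auto simp: dims c_def d_def poly_0_coeff_0 algebra_simps add_divide_distrib diff_divide_distrib)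
  show "(X n j has_field_derivative (poly (a n) z * X n j z + poly (b n) z * Y n j z) / poly W z) (at z)"
    using Y_ode[OF S_D(1,2)[OF assms(1)], of 0 j n] assms(2) unfolding 1 by (simp add: X_def[abs_def])
  show "(Y n j has_field_derivative (c n z * X n j z + d n z * Y n j z) / poly W z) (at z)"
    using Y_ode[OF S_D(1,2)[OF assms(1)], of 1 j n] assms(2) unfolding 2 by (simp add: Y_def[abs_def])
qed

text \<open>The minus sign before \<open>epsilon_star\<close> in \<open>Y_mat\<close> makes the
  second column obey the same recurrence as the polynomials.\<close>

lemma XY_Suc:
  assumes "z \<in> S" "j < 2"
  shows "X (Suc n) j z = k n * z * X n j z + p n * Y n j z"
    and "Y (Suc n) j z = q n * z * X n j z + k n * Y n j z"
proof -
  note z = S_D[OF assms(1)]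
  have "\<kappa> n * poly (\<phi> (Suc n)) z =
      \<kappa> (Suc n) * z * poly (\<phi> n) z + coeff (\<phi> (Suc n)) 0 * poly (reflect_poly (\<phi>b n)) z"
    "\<kappa> n * poly (reflect_poly (\<phi>b (Suc n))) z =
      \<kappa> (Suc n) * poly (reflect_poly (\<phi>b n)) z + coeff (\<phi>b (Suc n)) 0 * (z * poly (\<phi> n) z)"
    using arg_cong[OF recurrence[of n], of "\<lambda>p. poly p z"]
      arg_cong[OF recurrence_reflected[of n], of "\<lambda>p. poly p z"] by (simp_all add: mult_ac)
  moreover have "x = y / \<kappa> n" if "\<kappa> n * x = y" for x y
    using that \<kappa>_nz[of n] by (metis nonzero_mult_div_cancel_left)
  note div = this
  ultimately have j0: "poly (\<phi> (Suc n)) z = k n * z * poly (\<phi> n) z + p n * poly (reflect_poly (\<phi>b n)) z"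
    "poly (reflect_poly (\<phi>b (Suc n))) z = q n * z * poly (\<phi> n) z + k n * poly (reflect_poly (\<phi>b n)) z"
    by (auto dest!: div simp only: add_divide_distrib times_divide_eq_left times_divide_eq_right mult.assoc add.commute)
  have j1: "epsilon w \<phi> (Suc n) z = k n * z * epsilon w \<phi> n z - p n * epsilon_star w \<phi>b n z"
    "epsilon_star w \<phi>b (Suc n) z = k n * epsilon_star w \<phi>b n z - q n * z * epsilon w \<phi> n z"
    using div[OF epsilon_Suc[OF z(2,3), of n]] div[OF epsilon_star_Suc[OF z(2,3), of n]]
    by (simp_all only: diff_divide_distrib times_divide_eq_left times_divide_eq_right mult.assoc)
  have "j = 0 \<or> j = 1" using assms(2) by linarith
  then show "X (Suc n) j z = k n * z * X n j z + p n * Y n j z"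
    "Y (Suc n) j z = q n * z * X n j z + k n * Y n j z"
    unfolding atomize_conj
    by (elim disjE; simp only: X_simps Y_simps j0 j1)
      (simp_all add: algebra_simps add_divide_distrib diff_divide_distrib)
qed

lemma XY_det:
  assumes "z \<in> S"
  shows "X n 0 z * Y n 1 z - X n 1 z * Y n 0 z = - 2 * z ^ n / w z"
proof -
  have "X n 0 z * Y n 1 z - X n 1 z * Y n 0 z =
      - ((poly (\<phi> n) z * epsilon_star w \<phi>b n z + poly (reflect_poly (\<phi>b n)) z * epsilon w \<phi> n z) / w z)"
    unfolding X_simps Y_simps by (simp add: add_divide_distrib)
  also have "\<dots> = - 2 * z ^ n / w z"
    unfolding casoratian[OF S_D(2,3)[OF assms]] by simp
  finally show ?thesis .
qed

text \<open>Cramer's rule: the determinant -2 z^n / w is nonzero on \<open>S\<close>. This allows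
  \<open>Y_mat\<close> to be cancelled from matrix identities.\<close>

lemma XY_independent:
  assumes z: "z \<in> S" and "\<And>j. j < 2 \<Longrightarrow> \<alpha> * X n j z + \<beta> * Y n j z = 0"
  shows "\<alpha> = 0" "\<beta> = 0"
proof -
  let ?det = "X n 0 z * Y n 1 z - X n 1 z * Y n 0 z"
  have 0: "\<alpha> * X n 0 z + \<beta> * Y n 0 z = 0" "\<alpha> * X n 1 z + \<beta> * Y n 1 z = 0"
    using assms(2) by simp_all
  have "\<alpha> * ?det = (\<alpha> * X n 0 z + \<beta> * Y n 0 z) * Y n 1 z - (\<alpha> * X n 1 z + \<beta> * Y n 1 z) * Y n 0 z"
    "\<beta> * ?det = (\<alpha> * X n 1 z + \<beta> * Y n 1 z) * X n 0 z - (\<alpha> * X n 0 z + \<beta> * Y n 0 z) * X n 1 z"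
    by (simp_all add: algebra_simps)
  moreover have "?det \<noteq> 0" using XY_det[OF z] S_D[OF z] by simp
  ultimately show "\<alpha> = 0" "\<beta> = 0" unfolding 0 by auto
qed

text \<open>The logarithmic derivative of the determinant is the trace of the coefficient matrix;
  for -2 z^n / w it is n/z - 2V/W.\<close>

lemma trace:
  assumes z: "z \<in> S"
  shows "poly (a n) z + d n z = of_nat n * poly W1 z - 2 * poly V z"
proof -
  note zz = S_D[OF z]
  let ?det = "X n 0 z * Y n 1 z - X n 1 z * Y n 0 z"
  let ?det' = "(poly (a n) z + d n z) * ?det / poly W z"
  have "((\<lambda>z. X n 0 z * Y n 1 z - X n 1 z * Y n 0 z) has_field_derivative ?det') (at z)"
    by (rule DERIV_cong[OF DERIV_diff[OF DERIV_mult[OF XY_ode(1)[OF z] XY_ode(2)[OF z]]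
          DERIV_mult[OF XY_ode(1)[OF z] XY_ode(2)[OF z]]]])
      (use zz in \<open>simp_all add: field_simps\<close>)
  moreover have "((\<lambda>z. - 2 * z ^ n / w z) has_field_derivative
      (of_nat n * poly W1 z - 2 * poly V z) * (- 2 * z ^ n / w z) / poly W z) (at z)"
    using zz
    by (auto intro!: derivative_eq_intros zz(6) simp: divide_simps)
      (cases n; simp add: W_eq algebra_simps)
  then have "((\<lambda>z. X n 0 z * Y n 1 z - X n 1 z * Y n 0 z) has_field_derivative
      (of_nat n * poly W1 z - 2 * poly V z) * (- 2 * z ^ n / w z) / poly W z) (at z)"
    by (rule has_field_derivative_transform_within_open[OF _ open_S z]) (simp only: XY_det)
  ultimately have "?det' = (of_nat n * poly W1 z - 2 * poly V z) * (- 2 * z ^ n / w z) / poly W z"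
    by (rule DERIV_unique)
  then show ?thesis using zz unfolding XY_det[OF z] by simp
qed

text \<open>The four entries, row by row, of W (K' + K A_n) = W A_{n+1} K, where K has rows (k z, p)
  and (q z, k). Both sides come from differentiating Y_{n+1} = K Y_n, after which Y_n is
  cancelled.\<close>

lemma compatibility:
  assumes z: "z \<in> S"
  shows "k n * poly W z + k n * z * poly (a n) z + p n * c n z =
      k n * z * poly (a (Suc n)) z + q n * z * poly (b (Suc n)) z"
    and "k n * z * poly (b n) z + p n * d n z = p n * poly (a (Suc n)) z + k n * poly (b (Suc n)) z"
    and "q n * poly W z + q n * z * poly (a n) z + k n * c n z =
      k n * z * c (Suc n) z + q n * z * d (Suc n) z"
    and "q n * z * poly (b n) z + k n * d n z = p n * c (Suc n) z + k n * d (Suc n) z"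
proof -
  have clear: "\<alpha> * u + \<beta> * x + \<gamma> * y = r"
    if "\<alpha> + \<beta> * (x / u) + \<gamma> * (y / u) = r / u" "u \<noteq> 0" for \<alpha> \<beta> \<gamma> x y r u :: complex
    using that by (simp add: field_simps)
  have first: "(k n * poly W z + k n * z * poly (a n) z + p n * c n z
        - (k n * z * poly (a (Suc n)) z + q n * z * poly (b (Suc n)) z)) * X n j z
      + (k n * z * poly (b n) z + p n * d n z
        - (p n * poly (a (Suc n)) z + k n * poly (b (Suc n)) z)) * Y n j z = 0" if j: "j < 2" for j
  proof -
    have "((\<lambda>z. k n * z * X n j z + p n * Y n j z) has_field_derivative
        k n * X n j z + k n * z * ((poly (a n) z * X n j z + poly (b n) z * Y n j z) / poly W z)
        + p n * ((c n z * X n j z + d n z * Y n j z) / poly W z)) (at z)"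
      by (auto intro!: derivative_eq_intros XY_ode[OF z j] simp del: times_divide_eq_left times_divide_eq_right)
    then have "(X (Suc n) j has_field_derivative
        k n * X n j z + k n * z * ((poly (a n) z * X n j z + poly (b n) z * Y n j z) / poly W z)
        + p n * ((c n z * X n j z + d n z * Y n j z) / poly W z)) (at z)"
      by (rule has_field_derivative_transform_within_open[OF _ open_S z]) (simp only: XY_Suc(1) j)
    from clear[OF DERIV_unique[OF this XY_ode(1)[OF z j]] S_D(4)[OF z]] show ?thesis
      unfolding XY_Suc[OF z j]
      by (simp add: algebra_simps del: times_divide_eq_left times_divide_eq_right)
  qed
  have second: "(q n * poly W z + q n * z * poly (a n) z + k n * c n z
        - (k n * z * c (Suc n) z + q n * z * d (Suc n) z)) * X n j z
      + (q n * z * poly (b n) z + k n * d n z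
        - (p n * c (Suc n) z + k n * d (Suc n) z)) * Y n j z = 0" if j: "j < 2" for j
  proof -
    have "((\<lambda>z. q n * z * X n j z + k n * Y n j z) has_field_derivative
        q n * X n j z + q n * z * ((poly (a n) z * X n j z + poly (b n) z * Y n j z) / poly W z)
        + k n * ((c n z * X n j z + d n z * Y n j z) / poly W z)) (at z)"
      by (auto intro!: derivative_eq_intros XY_ode[OF z j] simp del: times_divide_eq_left times_divide_eq_right)
    then have "(Y (Suc n) j has_field_derivative
        q n * X n j z + q n * z * ((poly (a n) z * X n j z + poly (b n) z * Y n j z) / poly W z)
        + k n * ((c n z * X n j z + d n z * Y n j z) / poly W z)) (at z)"
      by (rule has_field_derivative_transform_within_open[OF _ open_S z]) (simp only: XY_Suc(2) j)
    from clear[OF DERIV_unique[OF this XY_ode(2)[OF z j]] S_D(4)[OF z]] show ?thesis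
      unfolding XY_Suc[OF z j]
      by (simp add: algebra_simps del: times_divide_eq_left times_divide_eq_right)
  qed
  show "k n * poly W z + k n * z * poly (a n) z + p n * c n z =
      k n * z * poly (a (Suc n)) z + q n * z * poly (b (Suc n)) z"
    "k n * z * poly (b n) z + p n * d n z = p n * poly (a (Suc n)) z + k n * poly (b (Suc n)) z"
    using XY_independent[OF z first] by simp_all
  show "q n * poly W z + q n * z * poly (a n) z + k n * c n z =
      k n * z * c (Suc n) z + q n * z * d (Suc n) z"
    "q n * z * poly (b n) z + k n * d n z = p n * c (Suc n) z + k n * d (Suc n) z"
    using XY_independent[OF z second] by simp_all
qed

text \<open>The upper right entry of the compatibility relation, with \<open>d n\<close> eliminated
  by the trace and divided by \<open>p n\<close>; the terms with \<open>\<Theta> n\<close>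
  cancel.\<close>

lemma \<Omega>_sum:
  "\<Omega> (Suc n) + \<Omega> n =
    Polynomial.smult (coeff (\<phi> (Suc (Suc n))) 0 / coeff (\<phi> (Suc n)) 0) (\<Theta> (Suc n))
    + Polynomial.smult (k (Suc n)) (pCons 0 (\<Theta> (Suc n))) - Polynomial.smult (of_nat n) W1"
proof (rule poly_eq_on_S)
  fix z assume z: "z \<in> S"
  have p: "p n \<noteq> 0" using \<phi>_0_nz \<kappa>_nz by simp
  have "k n * p (Suc n) = coeff (\<phi> (Suc (Suc n))) 0 / coeff (\<phi> (Suc n)) 0 * p n"
    using \<kappa>_nz[of "Suc n"] \<phi>_0_nz[of "Suc n"] by (simp add: field_simps)
  then have b: "k n * poly (b (Suc n)) z =
      p n * (coeff (\<phi> (Suc (Suc n))) 0 / coeff (\<phi> (Suc n)) 0 * poly (\<Theta> (Suc n)) z)"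
    by (simp only: b_def poly_smult mult.assoc[symmetric]) (simp only: mult_ac)
  have d: "d n z = of_nat n * poly W1 z - 2 * poly V z - poly (a n) z"
    using trace[OF z, of n] by (simp add: algebra_simps)
  have "k n * z * poly (b n) z = p n * (k n * z * poly (\<Theta> n) z)"
    by (simp add: b_def)
  then have "p n * (k n * z * poly (\<Theta> n) z + d n z) = p n * (poly (a (Suc n)) z
      + coeff (\<phi> (Suc (Suc n))) 0 / coeff (\<phi> (Suc n)) 0 * poly (\<Theta> (Suc n)) z)"
    using compatibility(2)[OF z, of n] b by (simp only: distrib_left)
  then have "k n * z * poly (\<Theta> n) z + d n z = poly (a (Suc n)) z
      + coeff (\<phi> (Suc (Suc n))) 0 / coeff (\<phi> (Suc n)) 0 * poly (\<Theta> (Suc n)) z"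
    using p by (simp only: mult_cancel_left) simp
  then show "poly (\<Omega> (Suc n) + \<Omega> n) z = poly (Polynomial.smult (coeff (\<phi> (Suc (Suc n))) 0 / coeff (\<phi> (Suc n)) 0) (\<Theta> (Suc n))
    + Polynomial.smult (k (Suc n)) (pCons 0 (\<Theta> (Suc n))) - Polynomial.smult (of_nat n) W1) z"
    unfolding d by (simp add: a_def algebra_simps)
qed

section \<open>The determinant of W A_n as a polynomial\<close>

definition dP where "dP n = Polynomial.smult (of_nat n) W1 - Polynomial.smult 2 V - a n"

text \<open>A polynomial extension of \<open>c n\<close>, read off from the first row of the compatibility relation.\<close>

definition cP where
  "cP n = Polynomial.smult (1 / (p n)\<^sup>2)
    (Polynomial.smult (k n) (pCons 0 (Polynomial.smult (k n) (pCons 0 (b n)) + Polynomial.smult (p n) (dP n)))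
     - Polynomial.smult (p n * k n) (W + pCons 0 (a n)) - pCons 0 (b (Suc n)))"

definition "detP n = a n * dP n - b n * cP n"

text \<open>The trace turns \<open>d n\<close> into a polynomial, which can be evaluated at the
  roots of \<open>W\<close>, all of them outside \<open>S\<close>.\<close>

lemma d_eq_dP: "z \<in> S \<Longrightarrow> d n z = poly (dP n) z"
  using trace[of z n] by (simp add: dP_def algebra_simps)

text \<open>The definition of \<open>cP\<close> with its denominator cleared. It holds at every z,
  in particular at the roots of \<open>W\<close>.\<close>

lemma cP_eq:
  "z * poly (b (Suc n)) z = k n * z * (k n * z * poly (b n) z + p n * poly (dP n) z)
    - p n * (k n * poly W z + k n * z * poly (a n) z + p n * poly (cP n) z)"
proof -
  have "p n \<noteq> 0" using \<phi>_0_nz \<kappa>_nz by simp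
  then have "(p n)\<^sup>2 * poly (cP n) z = k n * z * (k n * z * poly (b n) z + p n * poly (dP n) z)
    - p n * k n * (poly W z + z * poly (a n) z) - z * poly (b (Suc n)) z"
    unfolding cP_def poly_smult by (simp add: mult_ac)
  then show ?thesis by (simp add: power2_eq_square algebra_simps del: times_divide_eq_left times_divide_eq_right)
qed

text \<open>Eliminate \<open>a (Suc n)\<close> between the two first-row relations;
  \<open>kp_det\<close> leaves z \<open>b (Suc n)\<close>, and \<open>c n\<close> is solved for
  using that \<open>p n\<close> is nonzero.\<close>

lemma c_eq_cP:
  assumes z: "z \<in> S"
  shows "c n z = poly (cP n) z"
proof -
  have "p n \<noteq> 0" using \<phi>_0_nz \<kappa>_nz by simp
  have "z * poly (b (Suc n)) z = z * poly (b (Suc n)) z * (k n * k n - p n * q n)"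
    by (simp only: kp_det mult_1_right)
  also have "\<dots> = k n * z * (p n * poly (a (Suc n)) z + k n * poly (b (Suc n)) z)
      - p n * (k n * z * poly (a (Suc n)) z + q n * z * poly (b (Suc n)) z)"
    by (simp add: algebra_simps del: times_divide_eq_left times_divide_eq_right)
  also have "\<dots> = k n * z * (k n * z * poly (b n) z + p n * d n z)
      - p n * (k n * poly W z + k n * z * poly (a n) z + p n * c n z)"
    by (simp only: compatibility(1,2)[OF z])
  finally have "p n * p n * (poly (cP n) z - c n z) = 0"
    unfolding cP_eq[of z n] d_eq_dP[OF z]
    by (simp add: algebra_simps del: times_divide_eq_left times_divide_eq_right) auto
  then show ?thesis using \<open>p n \<noteq> 0\<close> by auto
qed

text \<open>Determinants of the compatibility relation: K' = K diag(1/z, 0), so the side of index n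
  is K (W A_n + diag(W/z, 0)), and det K = z cancels.\<close>

lemma detP_Suc: "pCons 0 (detP (Suc n)) = pCons 0 (detP n) + W * dP n"
proof (rule poly_eq_on_S)
  fix z assume z: "z \<in> S"
  note e = d_eq_dP[OF z] c_eq_cP[OF z]
  let ?K = "k n * k n - p n * q n"
  let ?A = "poly (a n) z" and ?B = "poly (b n) z" and ?C = "poly (cP n) z" and ?D = "poly (dP n) z"
  let ?A' = "poly (a (Suc n)) z" and ?B' = "poly (b (Suc n)) z"
    and ?C' = "poly (cP (Suc n)) z" and ?D' = "poly (dP (Suc n)) z"
  have "z * poly (detP (Suc n)) z * ?K =
      (k n * z * ?A' + q n * z * ?B') * (p n * ?C' + k n * ?D')
      - (p n * ?A' + k n * ?B') * (k n * z * ?C' + q n * z * ?D')"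
    by (simp add: detP_def algebra_simps del: times_divide_eq_left times_divide_eq_right)
  also have "\<dots> = (k n * poly W z + k n * z * ?A + p n * ?C) * (q n * z * ?B + k n * ?D)
      - (k n * z * ?B + p n * ?D) * (q n * poly W z + q n * z * ?A + k n * ?C)"
    using compatibility[OF z, of n] by (simp only: e)
  also have "\<dots> = (z * poly (detP n) z + poly W z * ?D) * ?K"
    by (simp add: detP_def algebra_simps del: times_divide_eq_left times_divide_eq_right)
  finally show "poly (pCons 0 (detP (Suc n))) z = poly (pCons 0 (detP n) + W * dP n) z"
    unfolding kp_det by simp
qed

text \<open>The first column of \<open>Y\<^sub>0\<close> is the constant vector \<open>(\<kappa>\<^sub>0, \<kappa>\<^sub>0)\<close>, which \<open>A\<^sub>0\<close> therefore annihilates.\<close>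

lemma row_sums_0:
  assumes z: "z \<in> S"
  shows "poly (a 0) z + poly (b 0) z = 0" "c 0 z + d 0 z = 0"
proof -
  have const: "X 0 0 = (\<lambda>z. \<kappa> 0)" "Y 0 0 = (\<lambda>z. \<kappa> 0)"
    unfolding fun_eq_iff X_simps Y_simps by (subst \<phi>_0, simp) (subst \<phi>b_0, simp)
  have "(poly (a 0) z * \<kappa> 0 + poly (b 0) z * \<kappa> 0) / poly W z = 0"
    "(c 0 z * \<kappa> 0 + d 0 z * \<kappa> 0) / poly W z = 0"
    using XY_ode[OF z, of 0 0] unfolding const by (auto dest: DERIV_unique[OF DERIV_const])
  then show "poly (a 0) z + poly (b 0) z = 0" "c 0 z + d 0 z = 0"
    using S_D(4)[OF z] \<kappa>_nz[of 0] by (simp_all add: distrib_right[symmetric])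
qed

lemma detP_0: "detP 0 = 0"
proof (rule poly_eq_on_S)
  fix z assume z: "z \<in> S"
  have "poly (b 0) z = - poly (a 0) z" "c 0 z = - d 0 z"
    using row_sums_0[OF z] by (simp_all add: eq_neg_iff_add_eq_0 add.commute)
  then show "poly (detP 0) z = poly 0 z"
    by (simp add: detP_def flip: d_eq_dP[OF z] c_eq_cP[OF z])
qed

lemma detP_root: "poly W z = 0 \<Longrightarrow> z \<noteq> 0 \<Longrightarrow> poly (detP n) z = 0"
proof (induction n)
  case (Suc n)
  then show ?case using arg_cong[OF detP_Suc[of n], of "\<lambda>p. poly p z"] by simp
qed (simp add: detP_0)

text \<open>Since \<open>W1\<close> vanishes too, \<Omega> + V and \<Omega> - V are expressed by the
  entries of W A_n. In their product a d is replaced by b c, as the determinant is 0, and the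
  remaining bracket is z \<open>b (Suc n)\<close> by \<open>cP_eq\<close>.\<close>

lemma \<Theta>_product:
  assumes W: "poly W z = 0" and z: "z \<noteq> 0"
  shows "coeff (\<phi> (Suc n)) 0 * \<kappa> (Suc n) * (poly (\<Omega> n + V) z * poly (\<Omega> n - V) z) =
    coeff (\<phi> (Suc (Suc n))) 0 * \<kappa> n * z * (poly (\<Theta> n) z * poly (\<Theta> (Suc n)) z)"
proof -
  have p: "p n \<noteq> 0" using \<phi>_0_nz \<kappa>_nz by simp
  have "poly W1 z = 0" using W z by (simp add: W_eq)
  then have plus: "p n * poly (\<Omega> n + V) z = k n * z * poly (b n) z - p n * poly (a n) z"
    and minus: "p n * poly (\<Omega> n - V) z = k n * z * poly (b n) z + p n * poly (dP n) z"
    by (simp_all add: a_def b_def dP_def algebra_simps del: times_divide_eq_left times_divide_eq_right)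
  have det: "poly (b n) z * poly (cP n) z = poly (a n) z * poly (dP n) z"
    using detP_root[OF W z, of n] by (simp add: detP_def)
  have "p n * poly (\<Omega> n + V) z * (p n * poly (\<Omega> n - V) z) =
      poly (b n) z * (k n * z * (k n * z * poly (b n) z + p n * poly (dP n) z)
        - p n * (k n * poly W z + k n * z * poly (a n) z))
      - p n * p n * (poly (a n) z * poly (dP n) z)"
    unfolding plus minus by (simp add: W algebra_simps del: times_divide_eq_left times_divide_eq_right)
  also have "\<dots> = poly (b n) z * (z * poly (b (Suc n)) z)"
    unfolding det[symmetric] cP_eq[of z n]
    by (simp add: algebra_simps del: times_divide_eq_left times_divide_eq_right)
  also have "\<dots> = p n * (p (Suc n) * z * (poly (\<Theta> n) z * poly (\<Theta> (Suc n)) z))"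
    by (simp add: b_def mult_ac)
  finally have "p n * (poly (\<Omega> n + V) z * poly (\<Omega> n - V) z) =
      p (Suc n) * z * (poly (\<Theta> n) z * poly (\<Theta> (Suc n)) z)"
    using p by (simp only: mult.assoc mult.left_commute[of "poly _ _"] mult_cancel_left) simp
  then show ?thesis
    using \<kappa>_nz[of n] \<kappa>_nz[of "Suc n"] by (simp add: field_simps)
qed

text \<open>The derivative of epsilon_0 / w is computed from the equation of F and from the first
  row of A_0. As \<open>a 0\<close> = - \<open>b 0\<close>, only epsilon_0 + epsilon_0^* enters the
  latter, which is free of F.\<close>

lemma initial_\<Theta>:
  "Polynomial.smult (2 * coeff (\<phi> 1) 0) (\<Theta> 0) =
    Polynomial.smult (\<kappa> 0) (Polynomial.smult 2 V - Polynomial.smult ((\<kappa> 0)\<^sup>2) U)"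
proof (rule poly_eq_on_S)
  fix z assume z: "z \<in> S"
  note zz = S_D[OF z]
  let ?F = "caratheodory w z" and ?w0 = "toeplitz_elem w 0"
  obtain F' where F: "(caratheodory w has_field_derivative F') (at z)"
    "poly W z * F' = 2 * poly V z * ?F + poly U z"
    using F_ode[OF zz(2)] by blast
  have w0: "\<kappa> 0 * (\<kappa> 0 * ?w0) = 1" using norm_0 by (simp add: power2_eq_square mult.assoc)
  have X1: "X 0 1 = (\<lambda>z. \<kappa> 0 * (?w0 + caratheodory w z) / w z)"
    unfolding fun_eq_iff X_simps by (simp add: epsilon_def)
  have XY: "X 0 1 z - Y 0 1 z = 2 * \<kappa> 0 * ?w0 / w z"
    unfolding X_simps Y_simps
    using lead[of 0]
    by (simp add: epsilon_def epsilon_star_def algebra_simps add_divide_distrib diff_divide_distrib)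
  have "(X 0 1 has_field_derivative
      (\<kappa> 0 * F' * w z - \<kappa> 0 * (?w0 + ?F) * (2 * poly V z / poly W z * w z)) / (w z * w z)) (at z)"
    unfolding X1 using zz(5) by (auto intro!: derivative_eq_intros F(1) zz(6))
  from DERIV_unique[OF this XY_ode(1)[OF z, of 1 0]]
  have "poly (a 0) z * X 0 1 z + poly (b 0) z * Y 0 1 z =
      poly W z * ((\<kappa> 0 * F' * w z - \<kappa> 0 * (?w0 + ?F) * (2 * poly V z / poly W z * w z)) / (w z * w z))"
    using zz(4) by simp
  also have "\<dots> = \<kappa> 0 * (poly W z * F' - (?w0 + ?F) * (2 * poly V z)) / w z"
    using zz(4,5) by (simp add: field_simps)
  also have "\<dots> = \<kappa> 0 * (poly U z - 2 * ?w0 * poly V z) / w z"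
    unfolding F(2) by (simp add: algebra_simps)
  finally have "- (poly (b 0) z * (X 0 1 z - Y 0 1 z)) = \<kappa> 0 * (poly U z - 2 * ?w0 * poly V z) / w z"
    using row_sums_0(1)[OF z] by (simp add: eq_neg_iff_add_eq_0[symmetric] algebra_simps)
  then have "\<kappa> 0 * (poly (b 0) z * (2 * ?w0)) = \<kappa> 0 * (2 * ?w0 * poly V z - poly U z)"
    unfolding XY using zz(5) by (simp add: field_simps)
  then have "poly (b 0) z * (2 * ?w0) = 2 * ?w0 * poly V z - poly U z"
    using \<kappa>_nz[of 0] by (simp only: mult_cancel_left) simp
  \<comment> \<open>The factor kappa_0^2 removes w_0 through the normalisation.\<close>
  then have "\<kappa> 0 * \<kappa> 0 * (poly (b 0) z * (2 * ?w0)) = \<kappa> 0 * \<kappa> 0 * (2 * ?w0 * poly V z - poly U z)"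
    by (rule arg_cong)
  then have "2 * poly (b 0) z = 2 * poly V z - (\<kappa> 0)\<^sup>2 * poly U z"
  proof -
    assume *: "\<kappa> 0 * \<kappa> 0 * (poly (b 0) z * (2 * ?w0)) = \<kappa> 0 * \<kappa> 0 * (2 * ?w0 * poly V z - poly U z)"
    have "2 * poly (b 0) z * (\<kappa> 0 * (\<kappa> 0 * ?w0)) = \<kappa> 0 * \<kappa> 0 * (poly (b 0) z * (2 * ?w0))"
      by simp
    also have "\<dots> = 2 * poly V z * (\<kappa> 0 * (\<kappa> 0 * ?w0)) - (\<kappa> 0)\<^sup>2 * poly U z"
      unfolding * by (simp add: power2_eq_square algebra_simps)
    finally show ?thesis unfolding w0 by simp
  qed
  then show "poly (Polynomial.smult (2 * coeff (\<phi> 1) 0) (\<Theta> 0)) z =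
      poly (Polynomial.smult (\<kappa> 0) (Polynomial.smult 2 V - Polynomial.smult ((\<kappa> 0)\<^sup>2) U)) z"
    using \<kappa>_nz[of 0] by (simp add: b_def field_simps)
qed

lemma initial_\<Omega>: "\<Omega> 0 + V = Polynomial.smult (p 0) (\<Theta> 0) + Polynomial.smult (k 0) (pCons 0 (\<Theta> 0))"
proof (rule poly_eq_on_S)
  fix z assume "z \<in> S"
  then show "poly (\<Omega> 0 + V) z = poly (Polynomial.smult (p 0) (\<Theta> 0) + Polynomial.smult (k 0) (pCons 0 (\<Theta> 0))) z"
    using row_sums_0(1)[of z] by (simp add: a_def b_def algebra_simps)
qed

end

section \<open>Vieta's formula, Vandermonde products and interpolation\<close>

text \<open>Expand over subsets: \<open>S\<close> collects the factors contributing -x, its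
  complement those contributing the variable.\<close>

lemma coeff_prod_linear:
  assumes "finite X" "i \<le> card X"
  shows "coeff (\<Prod>x\<in>X. [:- x, 1:]) i = (-1) ^ (card X - i) * esym X (card X - i)"
proof -
  have "(\<Prod>x\<in>X. [:- x, 1:]) = (\<Prod>x\<in>X. [:- x:] + [:0, 1:])" by simp
  also have "\<dots> = (\<Sum>S\<in>Pow X. (\<Prod>x\<in>S. [:- x:]) * [:0, 1:] ^ card (X - S))"
    by (simp only: prod_add[OF assms(1)] prod_constant)
  also have "\<dots> = (\<Sum>S\<in>Pow X. monom (\<Prod>x\<in>S. - x) (card X - card S))"
  proof (intro sum.cong refl)
    fix S assume "S \<in> Pow X"
    then have S: "finite S" "card (X - S) = card X - card S"
      using assms(1) by (auto intro: finite_subset card_Diff_subset)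
    have "(\<Prod>x\<in>S. [:- x:]) = [:\<Prod>x\<in>S. - x:]"
      using S(1) by induction auto
    then show "(\<Prod>x\<in>S. [:- x:]) * [:0, 1:] ^ card (X - S) = monom (\<Prod>x\<in>S. - x) (card X - card S)"
      by (simp add: S(2) monom_altdef)
  qed
  finally have "coeff (\<Prod>x\<in>X. [:- x, 1:]) i =
      (\<Sum>S\<in>Pow X. if card X - card S = i then (-1) ^ card S * (\<Prod>x\<in>S. x) else 0)"
    by (simp add: coeff_sum coeff_monom prod_uminus)
  also have "\<dots> = (\<Sum>S | S \<subseteq> X \<and> card S = card X - i. (-1) ^ card S * (\<Prod>x\<in>S. x))"
  proof -
    have "card X - card S = i \<longleftrightarrow> card S = card X - i" if "S \<subseteq> X" for S
      using card_mono[OF assms(1) that] assms(2) by linarith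
    then show ?thesis using assms by (intro sum.mono_neutral_cong_right) auto
  qed
  also have "\<dots> = (-1) ^ (card X - i) * esym X (card X - i)"
    unfolding esym_def sum_distrib_left by (intro sum.cong) auto
  finally show ?thesis .
qed

lemma esym_0 [simp]: "finite X \<Longrightarrow> esym X 0 = 1"
proof -
  assume "finite X"
  then have "{S. S \<subseteq> X \<and> card S = 0} = {{}}" by (auto simp: card_eq_0_iff dest: finite_subset)
  then show ?thesis by (simp add: esym_def)
qed

lemma esym_card: "finite X \<Longrightarrow> esym X (card X) = \<Prod>X"
proof -
  assume "finite X"
  then have "{S. S \<subseteq> X \<and> card S = card X} = {X}" by (auto dest: card_subset_eq)
  then show ?thesis by (simp add: esym_def)
qed

section \<open>Vandermonde products and removal of a node\<close>

lemma vandermonde_Cons: "vandermonde (x # xs) = (\<Prod>y\<leftarrow>xs. y - x) * vandermonde xs"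
proof -
  let ?n = "length xs" and ?g = "\<lambda>(j, k). (x # xs) ! k - (x # xs) ! j"
  let ?A = "Pair 0 ` Suc ` {..<?n}" and ?P = "{(j, k). j < k \<and> k < ?n}"
  have fin: "finite ?P" by (rule finite_subset[of _ "{..?n} \<times> {..?n}"]) auto
  have eq: "{(j, k). j < k \<and> k < length (x # xs)} = ?A \<union> map_prod Suc Suc ` ?P" (is "?L = ?R")
  proof (intro subset_antisym subsetI)
    fix p assume "p \<in> ?L"
    then show "p \<in> ?R"
      by (cases p; cases "fst p"; cases "snd p") (auto simp: image_iff)
  qed auto
  have "vandermonde (x # xs) = prod ?g ?A * prod ?g (map_prod Suc Suc ` ?P)"
    unfolding vandermonde_def eq using fin by (intro prod.union_disjoint) auto
  also have "prod ?g ?A = (\<Prod>k<?n. xs ! k - x)"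
    by (simp add: prod.reindex inj_on_def)
  also have "\<dots> = (\<Prod>y\<leftarrow>xs. y - x)"
    by (simp add: prod.list_conv_set_nth atLeast0LessThan)
  also have "prod ?g (map_prod Suc Suc ` ?P) = vandermonde xs"
    by (auto simp: prod.reindex inj_on_def vandermonde_def intro!: prod.cong)
  finally show ?thesis .
qed

lemma vandermonde_Nil [simp]: "vandermonde [] = 1"
  by (simp add: vandermonde_def)

lemma vandermonde_insert:
  "vandermonde (xs @ x # ys) = (\<Prod>y\<leftarrow>xs. x - y) * (\<Prod>y\<leftarrow>ys. y - x) * vandermonde (xs @ ys)"
  by (induction xs) (simp_all add: vandermonde_Cons algebra_simps)

lemma vandermonde_nonzero: "distinct xs \<Longrightarrow> vandermonde xs \<noteq> 0"
  by (induction xs) (auto simp: vandermonde_Cons prod_list_zero_iff)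

lemma prod_list_map_upt: "(\<Prod>k\<leftarrow>[a..<b]. g k) = (\<Prod>k\<in>{a..<b}. g k)"
  for g :: "nat \<Rightarrow> 'a::comm_monoid_mult"
  by (simp add: prod.distinct_set_conv_list[symmetric])

lemma vandermonde_append_one:
  "vandermonde (T_list N t @ [1]) = vandermonde (T_list N t) * (\<Prod>k=1..N. 1 - t k)"
proof -
  have "(\<Prod>y\<leftarrow>T_list N t. 1 - y) = (\<Prod>k=1..N. 1 - t k)"
    by (simp only: T_list_def map_map o_def prod_list_map_upt Suc_eq_plus1[symmetric] atLeastLessThanSuc_atLeastAtMost)
  then show ?thesis
    using vandermonde_insert[of "T_list N t" 1 "[]"] by simp
qed

text \<open>Pulling out t_l reverses the differences with the N - l later nodes and with 1; the sign
  exponent N - l + 1 differs from N - 1 + l by the even number 2 (l - 1).\<close>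

lemma vandermonde_delete:
  assumes l: "l \<in> {1..N}"
  shows "vandermonde (T_list N t @ [1]) =
    (-1) ^ (N - 1 + l) * vandermonde (T_del_one_list N t l) *
      ((t l - 1) * (\<Prod>k\<in>{1..N}-{l}. t l - t k))"
proof -
  have split: "{1..N} - {l} = {1..<l} \<union> {l+1..<N+1}" using l by auto
  have "[1..<N+1] = [1..<l] @ l # [l+1..<N+1]"
    using l upt_add_eq_append[of 1 l "N + 1 - l"] upt_conv_Cons[of l "N + 1"] by simp
  then have list: "T_list N t @ [1] = map t [1..<l] @ t l # (map t [l+1..<N+1] @ [1])"
    by (simp add: T_list_def)
  have 1: "(\<Prod>y\<leftarrow>map t [1..<l]. t l - y) = (\<Prod>k\<in>{1..<l}. t l - t k)"
    by (simp only: map_map o_def prod_list_map_upt)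
  have "(\<Prod>y\<leftarrow>map t [l+1..<N+1]. y - t l) = (\<Prod>k\<in>{l+1..<N+1}. - (t l - t k))"
    by (simp only: map_map o_def prod_list_map_upt minus_diff_eq)
  also have "\<dots> = (-1) ^ (N - l) * (\<Prod>k\<in>{l+1..<N+1}. t l - t k)"
    by (simp only: prod_uminus) simp
  finally have 2: "(\<Prod>y\<leftarrow>map t [l+1..<N+1] @ [1]. y - t l) =
      (-1) ^ (N - l) * (\<Prod>k\<in>{l+1..<N+1}. t l - t k) * (1 - t l)"
    by simp
  have 3: "(\<Prod>k\<in>{1..N}-{l}. t l - t k) =
      (\<Prod>k\<in>{1..<l}. t l - t k) * (\<Prod>k\<in>{l+1..<N+1}. t l - t k)"
    unfolding split by (intro prod.union_disjoint) auto
  have "N - 1 + l = (N - l) + 1 + 2 * (l - 1)" using l by auto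
  then have sgn: "(-1 :: complex) ^ (N - 1 + l) = - ((-1) ^ (N - l))"
    by (simp add: power_add)
  show ?thesis
    unfolding list vandermonde_insert 1 2 3 sgn T_del_one_list_def by (simp add: algebra_simps)
qed

text \<open>Lagrange interpolation at \<open>t\<^sub>1, \<dots>, t\<^sub>N, 1\<close>, multiplied by the Vandermonde product of the nodes.\<close>

lemma interpolation_omega_num:
  fixes P :: "complex poly" and c :: complex
  assumes inj: "inj_on t {1..N}" and t1: "\<And>j. j \<in> {1..N} \<Longrightarrow> t j \<noteq> 1"
    and deg: "degree P \<le> N" and P1: "poly P 1 = c"
    and Pt: "\<And>j. j \<in> {1..N} \<Longrightarrow> poly P (t j) = c * (t j * f n j)"
    and i: "i \<le> N"
  shows "vandermonde (T_list N t @ [1]) * coeff P i = c * (-1) ^ (N - i) * omega_num N t f n (N - i)"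
proof -
  let ?X = "T_set N t" and ?Y = "T_del_one_set N t" and ?D = "vandermonde (T_list N t @ [1])"
  let ?g = "\<lambda>l. (-1) ^ (N - 1 + l) * t l * vandermonde (T_del_one_list N t l) * f n l"
  define L where "L X = (\<Prod>x\<in>X. [:- x, 1:])" for X :: "complex set"
  \<comment> \<open>The product over T vanishes at every t_j, and the product over
    \<open>?Y l\<close> at every node except t_l. The Vandermonde weights supply the Lagrange
    denominators.\<close>
  define Q where "Q = Polynomial.smult (vandermonde (T_list N t)) (L ?X)
    + (\<Sum>l=1..N. Polynomial.smult (?g l) (L (?Y l)))"
  have fin: "finite ?X" "finite (?Y l)" for l by (auto simp: T_set_def T_del_one_set_def)
  have card: "card ?X = N" "l \<in> {1..N} \<Longrightarrow> card (?Y l) = N" for l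
  proof -
    show "card ?X = N" using inj by (simp add: T_set_def card_image)
    assume l: "l \<in> {1..N}"
    have "card (t ` ({1..N} - {l})) = N - 1"
      using l inj by (subst card_image) (auto intro: inj_on_subset)
    moreover have "1 \<notin> t ` ({1..N} - {l})" using t1 by (metis Diff_iff imageE)
    ultimately show "card (?Y l) = N" using l by (simp add: T_del_one_set_def)
  qed
  have deg_L: "degree (L X) \<le> card X" if "finite X" for X
    using degree_prod_sum_le[OF that, of "\<lambda>x. [:- x, 1:]"] by (simp add: L_def o_def)
  have poly_L: "poly (L X) z = (\<Prod>x\<in>X. z - x)" for X z
    by (simp add: L_def poly_prod)
  have root: "poly (L X) z = 0" if "finite X" "z \<in> X" for X z
    using that by (auto simp: poly_L)
  have Q1: "poly Q 1 = ?D"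
  proof -
    have "poly (L ?X) 1 = (\<Prod>k=1..N. 1 - t k)"
      using inj by (simp add: poly_L T_set_def prod.reindex)
    moreover have "poly (L (?Y l)) 1 = 0" for l
      by (rule root[OF fin(2)]) (simp add: T_del_one_set_def)
    ultimately show ?thesis by (simp add: Q_def poly_sum vandermonde_append_one del: mult_minus1_right)
  qed
  have Qt: "poly Q (t j) = ?D * (t j * f n j)" if j: "j \<in> {1..N}" for j
  proof -
    have "poly (L ?X) (t j) = 0" using j by (intro root[OF fin(1)]) (simp add: T_set_def)
    moreover have "poly (L (?Y l)) (t j) = 0" if "l \<noteq> j" for l
      using that j by (intro root[OF fin(2)]) (auto simp: T_del_one_set_def)
    ultimately have Y0: "poly Q (t j) = (\<Sum>l=1..N. ?g l * poly (L (?Y l)) (t j))"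
      "\<And>l. l \<noteq> j \<Longrightarrow> poly (L (?Y l)) (t j) = 0"
      by (simp_all add: Q_def poly_sum)
    have "poly Q (t j) = (\<Sum>l=1..N. if l = j then ?g j * poly (L (?Y j)) (t j) else 0)"
      unfolding Y0(1) by (intro sum.cong) (auto simp: Y0(2))
    also have "\<dots> = ?g j * poly (L (?Y j)) (t j)" using j by simp
    also have "poly (L (?Y j)) (t j) = (t j - 1) * (\<Prod>k\<in>{1..N}-{j}. t j - t k)"
    proof -
      have "1 \<notin> t ` ({1..N} - {j})" using t1 by (metis Diff_iff imageE)
      moreover have "inj_on t ({1..N} - {j})" using inj by (rule inj_on_subset) auto
      ultimately show ?thesis by (simp add: poly_L T_del_one_set_def prod.reindex)
    qed
    finally show ?thesis by (simp add: vandermonde_delete[OF j] mult_ac)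
  qed
  \<comment> \<open>Both sides have degree at most \<open>N\<close> and agree at N + 1 distinct
    nodes.\<close>
  have "Polynomial.smult ?D P = Polynomial.smult c Q"
  proof (rule poly_eqI_degree[of "insert 1 ?X"])
    fix x assume "x \<in> insert 1 ?X"
    then show "poly (Polynomial.smult ?D P) x = poly (Polynomial.smult c Q) x"
      by (auto simp: T_set_def Q1 P1 Qt Pt)
  next
    have "1 \<notin> ?X" using t1 by (auto simp: T_set_def)
    then have N1: "card (insert 1 ?X) = Suc N" using fin card by simp
    show "degree (Polynomial.smult ?D P) < card (insert 1 ?X)"
      using deg by (simp add: N1 le_less_trans[OF degree_smult_le])
    have "degree (L (?Y l)) \<le> N" if "l \<in> {1..N}" for l
      using deg_L[OF fin(2), of l] card(2)[OF that] by simp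
    moreover have "degree (L ?X) \<le> N" using deg_L[OF fin(1)] card(1) by simp
    ultimately have "degree Q \<le> N"
      unfolding Q_def
      by (intro degree_add_le degree_sum_le order_trans[OF degree_smult_le]) auto
    then show "degree (Polynomial.smult c Q) < card (insert 1 ?X)"
      by (simp add: N1 le_less_trans[OF degree_smult_le])
  qed
  then have "?D * coeff P i = c * coeff Q i"
    by (metis coeff_smult)
  also have "coeff Q i = (-1) ^ (N - i) * omega_num N t f n (N - i)"
  proof -
    have "coeff (L ?X) i = (-1) ^ (N - i) * esym ?X (N - i)"
      using coeff_prod_linear[OF fin(1)] i card by (simp add: L_def)
    moreover have "coeff (L (?Y l)) i = (-1) ^ (N - i) * esym (?Y l) (N - i)" if "l \<in> {1..N}" for l
      using coeff_prod_linear[OF fin(2)] i card(2)[OF that] by (simp add: L_def)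
    ultimately show ?thesis
      by (simp add: Q_def omega_num_def coeff_sum sum_distrib_left algebra_simps)
  qed
  finally show ?thesis by simp
qed

lemma omega_num_0: "omega_num N t f n 0 = omega_den2 N t f n"
  by (simp add: omega_num_def omega_den2_def T_set_def T_del_one_set_def mult_ac)

text \<open>e_N of an N-element set is its product, and the extra factor t_l restores the deleted
  node. Thus the constant coefficient of the interpolant involves \<open>omega_den1\<close>, just as
  its leading one is \<open>omega_den2\<close>.\<close>

lemma omega_num_N:
  assumes inj: "inj_on t {1..N}" and t1: "\<And>j. j \<in> {1..N} \<Longrightarrow> t j \<noteq> 1"
  shows "omega_num N t f n N = (\<Prod>k=1..N. t k) * omega_den1 N t f n"
proof -
  have "esym (T_set N t) N = (\<Prod>k=1..N. t k)"
    using esym_card[of "T_set N t"] inj by (simp add: T_set_def card_image prod.reindex)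
  moreover have "(\<Prod>k=1..N. t k) = t l * esym (T_del_one_set N t l) N" if l: "l \<in> {1..N}" for l
  proof -
    have inj': "inj_on t ({1..N} - {l})" using inj by (rule inj_on_subset) auto
    moreover have 1: "1 \<notin> t ` ({1..N} - {l})" using t1 by (metis Diff_iff imageE)
    ultimately have "card (T_del_one_set N t l) = N"
      using l by (simp add: T_del_one_set_def card_image)
    then have "esym (T_del_one_set N t l) N = (\<Prod>k\<in>{1..N}-{l}. t k)"
      using esym_card[of "T_del_one_set N t l"] 1 inj'
      by (simp add: T_del_one_set_def prod.reindex)
    then show ?thesis using l by (simp add: prod.remove[symmetric])
  qed
  ultimately show ?thesis
    unfolding omega_num_def omega_den1_def distrib_left sum_distrib_left
    by (intro arg_cong2[where f = "(+)"] sum.cong) (simp_all only: mult_ac)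
qed

section \<open>The recurrence relations\<close>

text \<open>Alternating forward step: the first relation at n yields f at n + 1 after cancelling t_j
  f_n^j, and the second at n + 1 then yields \<omega> at n + 1. Only the relations up to
  \<open>M\<close> are asked of \<open>g\<close> and \<open>v\<close>, so finite segments are
  determined as well.\<close>

lemma recurrences_determine:
  assumes nz: "\<And>n j. j \<in> {1..N} \<Longrightarrow> t j \<noteq> 0 \<and> f n j \<noteq> 0"
    and init: "initial_conditions N t w G f \<omega>" "initial_conditions N t w G g v"
    and f_rel: "\<And>n j. j \<in> {1..N} \<Longrightarrow> f_relation N t \<rho>0 m f \<omega> n j"
      "\<And>n j. n < M \<Longrightarrow> j \<in> {1..N} \<Longrightarrow> f_relation N t \<rho>0 m g v n j"
    and \<omega>_rel: "\<And>n j. n \<ge> 1 \<Longrightarrow> j \<in> {1..N} \<Longrightarrow> omega_relation N t \<rho>0 m f \<omega> n j"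
      "\<And>n j. n \<in> {1..M} \<Longrightarrow> j \<in> {1..N} \<Longrightarrow> omega_relation N t \<rho>0 m g v n j"
    and "n \<le> M"
  shows "\<forall>j\<in>{1..N}. g n j = f n j \<and> v n j = \<omega> n j"
  using \<open>n \<le> M\<close>
proof (induction n)
  case 0
  show ?case
  proof
    fix j assume "j \<in> {1..N}"
    then have "g 0 j = f 0 j" "(-1) ^ N * v 0 j = (-1) ^ N * \<omega> 0 j"
      using init unfolding initial_conditions_def by metis+
    then show "g 0 j = f 0 j \<and> v 0 j = \<omega> 0 j" by simp
  qed
next
  case (Suc n)
  then have IH: "g n j = f n j" "v n j = \<omega> n j" if "j \<in> {1..N}" for j using that by auto
  have g: "g (Suc n) j = f (Suc n) j" if j: "j \<in> {1..N}" for j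
  proof -
    have "(\<Sum>l=1..N. v n l) = (\<Sum>l=1..N. \<omega> n l)"
      "(\<Sum>l=1..N. v n l + (-1) ^ l * m (N+1-l)) = (\<Sum>l=1..N. \<omega> n l + (-1) ^ l * m (N+1-l))"
      using IH(2) by (auto intro!: sum.cong)
    then have "f_den1 N t \<rho>0 m v n = f_den1 N t \<rho>0 m \<omega> n" "f_den2 N t m v n = f_den2 N t m \<omega> n"
      unfolding f_den1_def f_den2_def by (simp_all only:)
    moreover have "(\<Sum>l=1..N. t j ^ (l-1) * v n l) = (\<Sum>l=1..N. t j ^ (l-1) * \<omega> n l)"
      "(\<Sum>l=1..N. t j ^ (l-1) * (v n l + (-1) ^ l * m (N+1-l))) =
        (\<Sum>l=1..N. t j ^ (l-1) * (\<omega> n l + (-1) ^ l * m (N+1-l)))"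
      using IH(2) by (auto intro!: sum.cong)
    ultimately have "t j * g n j * g (n + 1) j = t j * f n j * f (n + 1) j"
      using f_rel(1)[OF j, of n] f_rel(2)[of n j] Suc.prems j unfolding f_relation_def by simp
    then show ?thesis using nz[OF j, of n] by (simp add: IH(1)[OF j])
  qed
  have num: "omega_num N t g (Suc n) i = omega_num N t f (Suc n) i"
    and den: "omega_den1 N t g (Suc n) = omega_den1 N t f (Suc n)"
      "omega_den2 N t g (Suc n) = omega_den2 N t f (Suc n)" for i
    unfolding omega_num_def omega_den1_def omega_den2_def using g by (auto intro!: sum.cong)
  show ?case
  proof
    fix j assume j: "j \<in> {1..N}"
    have "omega_relation N t \<rho>0 m f \<omega> (Suc n) j" "omega_relation N t \<rho>0 m g v (Suc n) j"
      using Suc.prems j by (intro \<omega>_rel; simp)+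
    then have "v (Suc n) j + v (Suc n - 1) j + (-1) ^ j * m (N+1-j) =
        \<omega> (Suc n) j + \<omega> (Suc n - 1) j + (-1) ^ j * m (N+1-j)"
      unfolding omega_relation_def num den by (simp only:)
    then have "v (Suc n) j + v n j = \<omega> (Suc n) j + \<omega> n j" by simp
    then show "g (Suc n) j = f (Suc n) j \<and> v (Suc n) j = \<omega> (Suc n) j"
      using g[OF j] IH(2)[OF j] by simp
  qed
qed

lemma minus_one_power_diff:
  assumes "j \<le> N"
  shows "(-1 :: complex) ^ (N - j) = (-1) ^ N * (-1) ^ j" "(-1 :: complex) ^ (N + 1 - j) = - ((-1) ^ N * (-1) ^ j)"
proof -
  have "(-1 :: complex) ^ N = (-1) ^ (N - j) * (-1) ^ j"
    using assms by (simp flip: power_add)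
  moreover have "(-1 :: complex) ^ j * (-1) ^ j = 1"
    by (simp flip: power_add)
  ultimately show 1: "(-1 :: complex) ^ (N - j) = (-1) ^ N * (-1) ^ j" by (simp add: mult.assoc)
  show "(-1 :: complex) ^ (N + 1 - j) = - ((-1) ^ N * (-1) ^ j)"
    using assms 1 by (simp add: Suc_diff_le)
qed

text \<open>The nonvanishing claims make the quotients genuine, since division by zero gives 0 in
  HOL. Complete characterisation takes the form of uniqueness on every initial segment.\<close>

theorem proposition4p3:
  fixes N :: nat
    and t \<rho>s :: "nat \<Rightarrow> complex" and \<rho>0 \<rho> :: complex
    and w :: "complex \<Rightarrow> complex" and D :: "complex set"
    and W V U G :: "complex poly" and e m u :: "nat \<Rightarrow> complex"
    and \<phi> \<phi>b :: "nat \<Rightarrow> complex poly" and \<kappa> r :: "nat \<Rightarrow> complex"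
    and \<Theta> \<Omega> :: "nat \<Rightarrow> complex poly" and \<Theta>s \<Omega>s :: "nat \<Rightarrow> complex \<Rightarrow> complex"
    and \<theta> \<omega> f :: "nat \<Rightarrow> nat \<Rightarrow> complex"
  assumes N: "N \<ge> 1"
    \<comment> \<open>distinct singularities \<open>0, t\<^sub>1, \<dots>, t\<^sub>N, 1\<close> and their exponents\<close>
    and t_inj: "inj_on t {1..N}"
    and t_01: "\<And>j. j \<in> {1..N} \<Longrightarrow> t j \<noteq> 0 \<and> t j \<noteq> 1"
    and exponents: "\<rho>0 \<notin> \<nat>" "\<rho> \<notin> \<nat>" "\<And>j. j \<in> {1..N} \<Longrightarrow> \<rho>s j \<notin> \<nat>"
    \<comment> \<open>the polynomials \<open>W\<close>, \<open>2V\<close> and their coefficients\<close>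
    and e_def: "\<And>l. e l = esym (T_set N t \<union> {1}) l"
    and W_def: "W = [:0, 1:] * [:-1, 1:] * (\<Prod>j=1..N. [:- t j, 1:])"
    and V_def: "\<And>z. z \<notin> {0, 1} \<union> T_set N t \<Longrightarrow>
        2 * poly V z = poly W z * (\<rho>0 / z + \<rho> / (z - 1) + (\<Sum>j=1..N. \<rho>s j / (z - t j)))"
    and m_def: "Polynomial.smult 2 V = (\<Sum>l=0..N+1. monom ((-1) ^ (N+1-l) * m (N+1-l)) l)"
    \<comment> \<open>the weight, its Toeplitz elements and the equation \<open>WF' = 2VF + U\<close>\<close>
    and weight: "semiclassical_weight W V D w"
    and I_nz: "\<And>n. toeplitz_det w n \<noteq> 0"
    and u_0: "u 0 = (-1) ^ N * toeplitz_elem w 0 * m (N+1)"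
    and u_j: "\<And>j. j \<in> {1..N} \<Longrightarrow>
        u j = (-1) ^ (N-j) * toeplitz_elem w 0 * m (N+1-j)
          + 2 * (\<Sum>l=0..j-1. (-1) ^ (N+1-l) * (of_nat (j-l) * e (N+1-l) - m (N+1-l))
                              * toeplitz_elem w (int j - int l))"
    and u_N1: "u (N+1) = toeplitz_elem w 0 * m 0"
    and U_def: "U = (\<Sum>l=0..N+1. monom (u l) l)"
    and F_ode: "\<And>z. norm z \<noteq> 1 \<Longrightarrow>
        \<exists>F'. (caratheodory w has_field_derivative F') (at z) \<and>
             poly W z * F' = 2 * poly V z * caratheodory w z + poly U z"
    and toeplitz_rec: "\<And>j::int.
        (\<Sum>l=0..N+1. (-1) ^ l * ((of_int j - of_nat l) * e (N+1-l) - m (N+1-l))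
                      * toeplitz_elem w (j - int l)) = 0"
    \<comment> \<open>the bi-orthogonal polynomials and the spectral coefficients\<close>
    and biorth: "biorthogonal_system w \<phi> \<phi>b"
    and \<kappa>_def: "\<And>n. \<kappa> n = lead_coeff (\<phi> n)"
    and r_def: "\<And>n. r n = poly (\<phi> n) 0 / \<kappa> n"
    and Y_ode: "\<And>n z i j. z \<in> D \<Longrightarrow> norm z \<noteq> 1 \<Longrightarrow> i < 2 \<Longrightarrow> j < 2 \<Longrightarrow>
        ((\<lambda>z. Y_mat w \<phi> \<phi>b n z $$ (i, j)) has_field_derivative
          (A_mat W V \<phi> \<phi>b \<Theta> \<Omega> \<Theta>s \<Omega>s n z * Y_mat w \<phi> \<phi>b n z) $$ (i, j)) (at z)"
    and \<Theta>_form: "\<And>n. Polynomial.smult (\<kappa> (n+1) / \<kappa> n) (\<Theta> n) =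
        monom ((-1) ^ N * (of_nat n * e (N+1) - m (N+1)) * (r n / r (n+1))) 0
        + (\<Sum>l=1..N-1. monom (\<theta> n l) l)
        + monom (of_nat n + 1 + m 0) N"
    and \<Omega>_form: "\<And>n. \<Omega> n =
        monom ((-1) ^ N * (of_nat n * e (N+1) - 1 / 2 * m (N+1))) 0
        + Polynomial.smult ((-1) ^ N) (\<Sum>l=1..N. monom (\<omega> n l + 1 / 2 * (-1) ^ l * m (N+1-l)) l)
        + monom (1 + 1 / 2 * m 0) (N+1)"
    and f_def: "\<And>n j. j \<in> {1..N} \<Longrightarrow> t j * f n j = poly (\<Theta> n) (t j) / poly (\<Theta> n) 1"
    \<comment> \<open>genericity\<close>
    and gen_r: "\<And>n. r n \<noteq> 0"
    and gen_m0: "\<And>n::nat. of_nat n + 1 + m 0 \<noteq> 0"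
    and gen_\<Theta>_1: "\<And>n. poly (\<Theta> n) 1 \<noteq> 0"
    and gen_\<Theta>_t: "\<And>n j. j \<in> {1..N} \<Longrightarrow> poly (\<Theta> n) (t j) \<noteq> 0"
    and G_def: "G = Polynomial.smult 2 V - Polynomial.smult ((\<kappa> 0)\<^sup>2) U"
  shows
    "(\<forall>n. f_den1 N t \<rho>0 m \<omega> n \<noteq> 0 \<and> f_den2 N t m \<omega> n \<noteq> 0) \<and>
     (\<forall>n\<ge>1. omega_den1 N t f n \<noteq> 0 \<and> omega_den2 N t f n \<noteq> 0) \<and>
     poly G 1 \<noteq> 0 \<and> toeplitz_elem w (-1) \<noteq> 0 \<and>
     (\<forall>n. \<forall>j\<in>{1..N}. f_relation N t \<rho>0 m f \<omega> n j) \<and>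
     (\<forall>n\<ge>1. \<forall>j\<in>{1..N}. omega_relation N t \<rho>0 m f \<omega> n j) \<and>
     initial_conditions N t w G f \<omega> \<and>
     (\<forall>M g v.
        initial_conditions N t w G g v \<and>
        (\<forall>n<M. \<forall>j\<in>{1..N}. f_relation N t \<rho>0 m g v n j) \<and>
        (\<forall>n\<in>{1..M}. \<forall>j\<in>{1..N}. omega_relation N t \<rho>0 m g v n j) \<longrightarrow>
        (\<forall>n\<le>M. \<forall>j\<in>{1..N}. g n j = f n j \<and> v n j = \<omega> n j))"
proof -
  define W1 where "W1 = [:-1, 1:] * (\<Prod>j=1..N. [:- t j, 1:])"
  have W_W1: "W = pCons 0 W1" by (simp add: W_def W1_def mult.assoc)
  have phi_nz: "coeff (\<phi> n) 0 \<noteq> 0" for n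
    using gen_r[of n] by (simp add: r_def poly_0_coeff_0)
  interpret spectral_system w \<phi> \<phi>b W V U W1 D \<Theta> \<Omega> \<Theta>s \<Omega>s
  proof
    show "W \<noteq> 0" by (simp only: W_def mult_eq_0_iff) auto
    show "(\<lambda>x. w (circlepath 0 1 x)) absolutely_integrable_on {0..1}"
      using weight by (simp add: semiclassical_weight_def)
  qed (fact W_W1 weight F_ode Y_ode biorth phi_nz)+
  have \<kappa>_eq: "lead_coeff (\<phi> n) = \<kappa> n" for n by (simp add: \<kappa>_def)
  note \<kappa>_nonzero = \<kappa>_nz[unfolded \<kappa>_eq]
  have r_eq: "r n = coeff (\<phi> n) 0 / \<kappa> n" for n by (simp add: r_def poly_0_coeff_0)

  \<comment> \<open>Coefficients and values of \<open>W\<close>, \<open>V\<close> and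
    \<open>\<Omega> n\<close>\<close>
  let ?X = "T_set N t \<union> {1}"
  have X: "finite ?X" "card ?X = N + 1"
  proof -
    have "1 \<notin> T_set N t" using t_01 by (auto simp: T_set_def)
    moreover have "card (T_set N t) = N" using t_inj by (simp add: T_set_def card_image)
    ultimately show "finite ?X" "card ?X = N + 1" by (simp_all add: T_set_def)
  qed
  have W1_prod: "W1 = (\<Prod>x\<in>?X. [:- x, 1:])"
  proof -
    have "1 \<notin> t ` {1..N}" using t_01 by auto
    then show ?thesis using t_inj by (simp add: W1_def T_set_def prod.reindex)
  qed
  have coeff_W1: "coeff W1 i = (-1) ^ (N+1-i) * e (N+1-i)" if "i \<le> N + 1" for i
    using coeff_prod_linear[OF X(1), of i] that unfolding W1_prod e_def X(2) by simp
  have e_top: "e (N+1) = (\<Prod>k=1..N. t k)"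
  proof -
    have "1 \<notin> t ` {1..N}" using t_01 by auto
    then show ?thesis
      unfolding e_def esym_card[OF X(1), unfolded X(2)]
      using t_inj by (simp add: T_set_def prod.reindex)
  qed
  have e_top_nz: "(\<Prod>k=1..N. t k) \<noteq> 0" using t_01 by auto

  have coeff_V: "2 * coeff V l = (-1) ^ (N+1-l) * m (N+1-l)" if "l \<le> N + 1" for l
    using arg_cong[OF m_def, of "\<lambda>p. coeff p l"] that by (simp add: coeff_sum coeff_monom)
  have m_top: "m (N+1) = \<rho>0 * e (N+1)"
  proof -
    \<comment> \<open>The defining formula of 2V with the factor z of \<open>W\<close> cancelled. It
      is continuous at 0, where the formula itself is not assumed, so the value of V there is
      obtained as a limit.\<close>
    let ?g = "\<lambda>z. poly W1 z * (\<rho>0 + z * (\<rho> / (z - 1) + (\<Sum>j=1..N. \<rho>s j / (z - t j))))"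
    have "open (- ?X)" "0 \<in> - ?X"
      using X(1) t_01 by (auto simp: T_set_def finite_imp_closed simp del: Compl_Un)
    from eventually_nhds_in_open[OF this]
    have "eventually (\<lambda>z. z \<notin> ?X) (nhds 0)" by (simp only: Compl_iff)
    then have "eventually (\<lambda>z. 2 * poly V z = ?g z) (at 0)"
      unfolding eventually_at_filter
      by eventually_elim (auto simp: V_def W_W1 algebra_simps)
    moreover have "?g \<midarrow>0\<rightarrow> ?g 0"
      using t_01 by (intro isContD continuous_intros) auto
    ultimately have "(\<lambda>z. 2 * poly V z) \<midarrow>0\<rightarrow> ?g 0"
      by (rule iffD2[OF tendsto_cong])
    moreover have "(\<lambda>z. 2 * poly V z) \<midarrow>0\<rightarrow> 2 * poly V 0"
      by (intro isContD continuous_intros)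
    ultimately have "2 * poly V 0 = ?g 0"
      by (rule LIM_unique[rotated])
    then have "2 * poly V 0 = poly W1 0 * \<rho>0" by simp
    then show ?thesis
      using coeff_V[of 0] coeff_W1[of 0] by (simp add: poly_0_coeff_0)
  qed

  have coeff_\<Omega>: "coeff (\<Omega> n) j = (-1) ^ N * (\<omega> n j + 1 / 2 * (-1) ^ j * m (N+1-j))"
    if "j \<in> {1..N}" for n j
    using that by (subst \<Omega>_form) (auto simp: coeff_sum coeff_monom)
  define S1 where "S1 n z = (\<Sum>l=1..N. \<omega> n l * z ^ l)" for n z
  define S2 where "S2 z = (\<Sum>l=1..N. (-1) ^ l * m (N+1-l) * z ^ l)" for z
  have poly_V: "2 * poly V z = - ((-1) ^ N * m (N+1)) - (-1) ^ N * S2 z + m 0 * z ^ (N+1)" for z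
  proof -
    have "2 * poly V z = (\<Sum>l=0..N+1. (-1) ^ (N+1-l) * m (N+1-l) * z ^ l)"
      using arg_cong[OF m_def, of "\<lambda>p. poly p z"] by (simp add: poly_sum poly_monom)
    also have "\<dots> = (\<Sum>l=0..N. (-1) ^ (N+1-l) * m (N+1-l) * z ^ l) + m 0 * z ^ (N+1)"
      by simp
    also have "(\<Sum>l=0..N. (-1) ^ (N+1-l) * m (N+1-l) * z ^ l) =
        (\<Sum>l=0..N. - ((-1) ^ N * ((-1) ^ l * m (N+1-l) * z ^ l)))"
      by (intro sum.cong refl) (simp only: minus_one_power_diff(2) atLeastAtMost_iff, simp)
    also have "\<dots> = - ((-1) ^ N * m (N+1)) - (-1) ^ N * (\<Sum>l=1..N. (-1) ^ l * m (N+1-l) * z ^ l)"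
      by (simp only: sum.atLeast_Suc_atMost[of 0 N] sum_negf flip: sum_distrib_left) (simp add: distrib_left)
    finally show ?thesis by (simp only: S2_def)
  qed
  have poly_\<Omega>: "poly (\<Omega> n) z = (-1) ^ N * (of_nat n * e (N+1) - 1 / 2 * m (N+1))
      + (-1) ^ N * (S1 n z + 1 / 2 * S2 z) + (1 + 1 / 2 * m 0) * z ^ (N+1)" for n z
  proof -
    have "(\<Sum>l=1..N. (\<omega> n l + 1 / 2 * (-1) ^ l * m (N+1-l)) * z ^ l) = S1 n z + 1 / 2 * S2 z"
      by (simp only: S1_def S2_def distrib_right sum.distrib sum_distrib_left mult.assoc)
    then show ?thesis
      by (subst \<Omega>_form) (simp add: poly_sum poly_monom)
  qed
  have sign: "(-1) ^ N * ((-1) ^ N * x) = x" for x :: complex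
    by (simp flip: mult.assoc power_add)
  \<comment> \<open>At z = 1 the right side is \<open>f_den1\<close>; at z = t_j it is t_j times the
    first numerator of \<open>f_relation\<close>. The analogous formula for \<Omega> - V gives the
    second fraction.\<close>
  have plus: "(-1) ^ N * poly (\<Omega> n + V) z = (of_nat n - \<rho>0) * (\<Prod>k=1..N. t k)
      + (\<Sum>l=1..N. \<omega> n l * z ^ l) + (-1) ^ N * (1 + m 0) * z ^ (N+1)" for n z
  proof -
    have "2 * poly (\<Omega> n + V) z = 2 * ((-1) ^ N * (of_nat n * e (N+1) - m (N+1))
      + (-1) ^ N * S1 n z + (1 + m 0) * z ^ (N+1))"
      unfolding poly_add distrib_left[of 2 _ "poly V z"] poly_V poly_\<Omega> by (simp add: algebra_simps)
    then have "poly (\<Omega> n + V) z = (-1) ^ N * (of_nat n * e (N+1) - m (N+1))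
      + (-1) ^ N * S1 n z + (1 + m 0) * z ^ (N+1)"
      by (simp only: mult_cancel_left) simp
    then show ?thesis
      by (simp only: distrib_left sign S1_def m_top e_top) (simp add: algebra_simps)
  qed
  have minus: "(-1) ^ N * poly (\<Omega> n - V) z = of_nat n * (\<Prod>k=1..N. t k)
      + (\<Sum>l=1..N. (\<omega> n l + (-1) ^ l * m (N+1-l)) * z ^ l) + (-1) ^ N * z ^ (N+1)" for n z
  proof -
    have "2 * poly (\<Omega> n - V) z =
        2 * ((-1) ^ N * (of_nat n * e (N+1)) + (-1) ^ N * (S1 n z + S2 z) + z ^ (N+1))"
      unfolding poly_diff right_diff_distrib[of 2 _ "poly V z"] poly_V poly_\<Omega> by (simp add: algebra_simps)
    then have "poly (\<Omega> n - V) z = (-1) ^ N * (of_nat n * e (N+1)) + (-1) ^ N * (S1 n z + S2 z) + z ^ (N+1)"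
      by (simp only: mult_cancel_left) simp
    moreover have "S1 n z + S2 z = (\<Sum>l=1..N. (\<omega> n l + (-1) ^ l * m (N+1-l)) * z ^ l)"
      by (simp only: S1_def S2_def distrib_right sum.distrib)
    ultimately show ?thesis
      by (simp only: distrib_left[of "(-1) ^ N"] sign e_top)
  qed
  have prod_t: "(\<Prod>k=1..N. t k) = t j * (\<Prod>k\<in>{1..N}-{j}. t k)" if "j \<in> {1..N}" for j
    using that by (simp add: prod.remove)
  have pow_t: "(\<Sum>l=1..N. c l * t j ^ l) = t j * (\<Sum>l=1..N. t j ^ (l-1) * c l)" for c j
    unfolding sum_distrib_left by (intro sum.cong) (auto simp: power_eq_if)

  \<comment> \<open>The recurrence for \<open>f\<close>\<close>
  have root: "poly W 1 = 0" "\<And>j. j \<in> {1..N} \<Longrightarrow> poly W (t j) = 0"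
    by (auto simp: W_def poly_prod)
  \<comment> \<open>This is \<open>p (Suc n)\<close> / \<open>p n\<close>, the factor common to all
    nonzero roots of \<open>W\<close>.\<close>
  define C where "C n = coeff (\<phi> (Suc (Suc n))) 0 * \<kappa> n / (coeff (\<phi> (Suc n)) 0 * \<kappa> (Suc n))" for n
  have C_nz: "C n \<noteq> 0" for n using phi_nz \<kappa>_nonzero by (simp add: C_def)
  have product: "poly (\<Omega> n + V) z * poly (\<Omega> n - V) z = C n * z * (poly (\<Theta> n) z * poly (\<Theta> (Suc n)) z)"
    if "poly W z = 0" "z \<noteq> 0" for n z
    using \<Theta>_product[OF that, of n] phi_nz[of "Suc n"] \<kappa>_nonzero[of "Suc n"] unfolding \<kappa>_eq C_def
    by (simp add: field_simps)
  have den: "f_den1 N t \<rho>0 m \<omega> n = (-1) ^ N * poly (\<Omega> n + V) 1"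
    "f_den2 N t m \<omega> n = (-1) ^ N * poly (\<Omega> n - V) 1" for n
    unfolding plus minus by (simp_all add: f_den1_def f_den2_def)
  \<comment> \<open>The product formula at the root 1 reduces both denominators to the nonzero
    values of \<Theta> at 1.\<close>
  have at_1_nz: "poly (\<Omega> n + V) 1 * poly (\<Omega> n - V) 1 \<noteq> 0" for n
    unfolding product[OF root(1) one_neq_zero] using C_nz gen_\<Theta>_1 by simp
  then have den_nz: "f_den1 N t \<rho>0 m \<omega> n \<noteq> 0 \<and> f_den2 N t m \<omega> n \<noteq> 0" for n
    unfolding den by simp

  have f_eq: "f n j = poly (\<Theta> n) (t j) / (t j * poly (\<Theta> n) 1)" if "j \<in> {1..N}" for n j
    using f_def[OF that, of n] t_01[OF that]
    by (metis divide_divide_eq_left mult.commute nonzero_mult_div_cancel_left)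
  have solve: "x = y / z" if "z * x = y" "z \<noteq> 0" for x y z :: complex
    using that by auto
  have f_rel: "f_relation N t \<rho>0 m f \<omega> n j" if j: "j \<in> {1..N}" for n j
  proof -
    have tj: "t j \<noteq> 0" using t_01[OF j] by simp
    let ?A = "(of_nat n - \<rho>0) * (\<Prod>k\<in>{1..N}-{j}. t k) + (\<Sum>l=1..N. t j ^ (l-1) * \<omega> n l)
          + (-1) ^ N * (1 + m 0) * t j ^ N"
    let ?B = "of_nat n * (\<Prod>k\<in>{1..N}-{j}. t k)
          + (\<Sum>l=1..N. t j ^ (l-1) * (\<omega> n l + (-1) ^ l * m (N+1-l))) + (-1) ^ N * t j ^ N"
    have "t j * ?A = (-1) ^ N * poly (\<Omega> n + V) (t j)"
      unfolding plus pow_t prod_t[OF j] by (simp add: algebra_simps)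
    then have A: "?A = (-1) ^ N * poly (\<Omega> n + V) (t j) / t j"
      using tj by (rule solve)
    have "t j * ?B = (-1) ^ N * poly (\<Omega> n - V) (t j)"
      unfolding minus pow_t prod_t[OF j] by (simp add: algebra_simps)
    then have B: "?B = (-1) ^ N * poly (\<Omega> n - V) (t j) / t j"
      using tj by (rule solve)
    have "?A / f_den1 N t \<rho>0 m \<omega> n * (?B / f_den2 N t m \<omega> n) =
        (poly (\<Omega> n + V) (t j) * poly (\<Omega> n - V) (t j)) /
        (t j * t j * (poly (\<Omega> n + V) 1 * poly (\<Omega> n - V) 1))"
      unfolding A B den by simp
    also have "\<dots> = poly (\<Theta> n) (t j) * poly (\<Theta> (Suc n)) (t j) / (t j * (poly (\<Theta> n) 1 * poly (\<Theta> (Suc n)) 1))"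
      unfolding product[OF root(2)[OF j] tj] product[OF root(1) one_neq_zero] using tj C_nz[of n] by simp
    also have "\<dots> = t j * f n j * f (n + 1) j"
      unfolding f_eq[OF j] using tj by simp
    finally show ?thesis by (simp add: f_relation_def)
  qed

  \<comment> \<open>The recurrence for \<open>\<omega>\<close>\<close>
  have omega_both: "omega_den1 N t f n \<noteq> 0 \<and> omega_den2 N t f n \<noteq> 0 \<and>
      (\<forall>j\<in>{1..N}. omega_relation N t \<rho>0 m f \<omega> n j)" if n: "n \<ge> 1" for n
  proof -
    \<comment> \<open>Normalised so that \<open>\<Theta>_form\<close> prescribes the leading and the
      constant coefficient: the former determines the scale \<open>c\<close>, the latter
      \<open>R * c\<close>.\<close>
    define P where "P = Polynomial.smult (\<kappa> (n+1) / \<kappa> n) (\<Theta> n)"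
    define c where "c = poly P 1 / vandermonde (T_list N t @ [1])"
    define R where "R = r (n+1) / r n"
    have R: "R \<noteq> 0" using gen_r by (simp add: R_def)
    have V_nz: "vandermonde (T_list N t @ [1]) \<noteq> 0"
    proof (rule vandermonde_nonzero)
      have "1 \<notin> t ` {1..N}" using t_01 by auto
      moreover have "set [1..<N+1] = {1..N}" by auto
      ultimately show "distinct (T_list N t @ [1])"
        using t_inj by (simp add: T_list_def distinct_map del: upt_Suc)
    qed
    have c_nz: "c \<noteq> 0" using gen_\<Theta>_1[of n] \<kappa>_nonzero V_nz by (simp add: c_def P_def)
    have coeff_P: "coeff P i = c * (-1) ^ (N - i) * omega_num N t f n (N - i)" if "i \<le> N" for i
    proof -
      have "degree P \<le> N"
        unfolding P_def \<Theta>_form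
        by (intro degree_add_le degree_sum_le order_trans[OF degree_monom_le]) auto
      moreover have "poly P (t j) = poly P 1 * (t j * f n j)" if "j \<in> {1..N}" for j
        using f_def[OF that, of n] gen_\<Theta>_1[of n] by (simp add: P_def)
      ultimately have "vandermonde (T_list N t @ [1]) * coeff P i =
          poly P 1 * (-1) ^ (N - i) * omega_num N t f n (N - i)"
        using interpolation_omega_num[OF t_inj _ _ refl _ that] t_01 by blast
      then show ?thesis using V_nz by (simp add: c_def field_simps)
    qed
    \<comment> \<open>The constant monomial does not interfere because \<open>N\<close> is at least
      1.\<close>
    have "coeff P N = of_nat n + 1 + m 0"
      unfolding P_def \<Theta>_form using N by (auto simp: coeff_sum coeff_monom)
    then have den2: "c * omega_den2 N t f n = of_nat n + 1 + m 0"
      using coeff_P[of N] by (simp add: omega_num_0)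
    have "coeff P 0 = (-1) ^ N * (of_nat n * e (N+1) - m (N+1)) * (r n / r (n+1))"
      unfolding P_def \<Theta>_form using N by (auto simp: coeff_sum coeff_monom)
    then have "coeff P 0 = (-1) ^ N * ((\<Prod>k=1..N. t k) * ((of_nat n - \<rho>0) / R))"
      unfolding m_top e_top R_def by (simp add: algebra_simps diff_divide_distrib)
    moreover have "omega_num N t f n N = (\<Prod>k=1..N. t k) * omega_den1 N t f n"
      using t_01 by (intro omega_num_N t_inj) auto
    ultimately have "(-1) ^ N * ((\<Prod>k=1..N. t k) * (c * omega_den1 N t f n)) =
        (-1) ^ N * ((\<Prod>k=1..N. t k) * ((of_nat n - \<rho>0) / R))"
      using coeff_P[of 0] by (simp only: diff_zero le0 mult_ac)
    then have "c * omega_den1 N t f n = (of_nat n - \<rho>0) / R"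
      using e_top_nz by (simp only: mult_cancel_left) simp
    then have den1: "R * c * omega_den1 N t f n = of_nat n - \<rho>0"
      using R by (simp add: field_simps)
    \<comment> \<open>Here the assumption that \<rho>0 is not a non-negative integer makes
      \<open>omega_den1\<close> nonzero.\<close>
    have "of_nat n \<noteq> \<rho>0" using exponents(1) by auto
    then have nz: "omega_den1 N t f n \<noteq> 0" "omega_den2 N t f n \<noteq> 0"
      using den1 den2 gen_m0[of n] by auto
    have num: "R * c * x = (of_nat n - \<rho>0) * (x / omega_den1 N t f n)"
      "c * x = (of_nat n + 1 + m 0) * (x / omega_den2 N t f n)" for x
      unfolding den1[symmetric] den2[symmetric] using nz by simp_all
    have "omega_relation N t \<rho>0 m f \<omega> n j" if j: "j \<in> {1..N}" for j
    proof -
      obtain n' where n': "n = Suc n'" using n by (cases n) auto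
      obtain j' where j': "j = Suc j'" using j by (cases j) auto
      have "coeff (\<phi> (Suc n)) 0 / coeff (\<phi> n) 0 * coeff (\<Theta> n) j = R * coeff P j"
        using \<kappa>_nonzero[of n] \<kappa>_nonzero[of "Suc n"] phi_nz[of n] by (simp add: R_def P_def r_eq field_simps)
      moreover have "\<kappa> (Suc n) / \<kappa> n * coeff (\<Theta> n) j' = coeff P j'"
        by (simp add: P_def)
      \<comment> \<open>\<open>\<Omega>_sum\<close> is used at n - 1, hence the factor n - 1 before
        \<open>W1\<close>; the term with z \<Theta> contributes its coefficient of index j -
        1.\<close>
      ultimately have "coeff (\<Omega> n) j + coeff (\<Omega> (n - 1)) j =
          R * coeff P j + coeff P j' - (of_nat n - 1) * coeff W1 j"
        using arg_cong[OF \<Omega>_sum[of n'], of "\<lambda>p. coeff p j"] unfolding \<kappa>_eq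
        by (simp add: n' j')
      then have "(-1) ^ N * (\<omega> n j + \<omega> (n-1) j + (-1) ^ j * m (N+1-j)) =
          (-1) ^ N * ((-1) ^ j * (of_nat n - 1) * e (N+1-j)
            + (-1) ^ j * (R * c * omega_num N t f n (N-j))
            - (-1) ^ j * (c * omega_num N t f n (N+1-j)))"
      proof -
        assume *: "coeff (\<Omega> n) j + coeff (\<Omega> (n - 1)) j =
          R * coeff P j + coeff P j' - (of_nat n - 1) * coeff W1 j"
        have jN: "j \<le> N" "j' \<le> N" "N - j' = N + 1 - j" using j j' by auto
        show ?thesis
          using * coeff_P[OF jN(1)] coeff_P[OF jN(2)] coeff_W1[of j] jN(1)
          unfolding coeff_\<Omega>[OF j] jN(3) minus_one_power_diff[OF jN(1)]
          by (simp add: algebra_simps)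
      qed
      then have "\<omega> n j + \<omega> (n-1) j + (-1) ^ j * m (N+1-j) = (-1) ^ j * (of_nat n - 1) * e (N+1-j)
            + (-1) ^ j * (R * c * omega_num N t f n (N-j))
            - (-1) ^ j * (c * omega_num N t f n (N+1-j))"
        by (simp only: mult_cancel_left) simp
      then show ?thesis
        unfolding num omega_relation_def e_def by (simp only: mult.assoc)
    qed
    with nz show ?thesis by blast
  qed

  \<comment> \<open>The initial conditions\<close>
  have c1: "coeff (\<phi> 1) 0 \<noteq> 0" by (rule phi_nz)
  have \<Theta>_0: "\<Theta> 0 = Polynomial.smult (\<kappa> 0 / (2 * coeff (\<phi> 1) 0)) G"
  proof -
    have "Polynomial.smult (1 / (2 * coeff (\<phi> 1) 0)) (Polynomial.smult (2 * coeff (\<phi> 1) 0) (\<Theta> 0)) =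
        Polynomial.smult (1 / (2 * coeff (\<phi> 1) 0)) (Polynomial.smult (\<kappa> 0) G)"
      unfolding initial_\<Theta>[unfolded \<kappa>_eq] G_def ..
    then show ?thesis using c1 by simp
  qed
  have G1: "poly G 1 \<noteq> 0" using gen_\<Theta>_1[of 0] by (simp add: \<Theta>_0)
  have w0: "toeplitz_elem w 0 \<noteq> 0" using norm_0 by auto
  have w1: "coeff (\<phi> 1) 0 * toeplitz_elem w 0 = - \<kappa> 1 * toeplitz_elem w (-1)"
    using coeff_\<phi>_1 unfolding \<kappa>_eq .
  then have w1_nz: "toeplitz_elem w (-1) \<noteq> 0" using c1 w0 by auto
  have init: "initial_conditions N t w G f \<omega>"
    unfolding initial_conditions_def
  proof (intro ballI conjI)
    fix j assume j: "j \<in> {1..N}"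
    show "f 0 j = poly G (t j) / (t j * poly G 1)"
      unfolding f_eq[OF j] \<Theta>_0 using c1 \<kappa>_nonzero[of 0] by simp
    obtain j' where j': "j = Suc j'" using j by (cases j) auto
    have "j \<le> N + 1" "j \<le> N" using j by auto
    have "2 * coeff (\<Omega> 0 + V) j = 2 * ((-1) ^ N * \<omega> 0 j)"
      unfolding coeff_add distrib_left[of 2 _ "coeff V j"] coeff_V[OF \<open>j \<le> N + 1\<close>] coeff_\<Omega>[OF j]
        minus_one_power_diff(2)[OF \<open>j \<le> N\<close>]
      by (simp add: algebra_simps)
    then have "coeff (\<Omega> 0 + V) j = (-1) ^ N * \<omega> 0 j"
      by (simp only: mult_cancel_left) simp
    then have "(-1) ^ N * \<omega> 0 j =
        coeff (\<phi> 1) 0 / \<kappa> 0 * coeff (\<Theta> 0) j + \<kappa> 1 / \<kappa> 0 * coeff (\<Theta> 0) (j - 1)"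
      using arg_cong[OF initial_\<Omega>, of "\<lambda>p. coeff p j"] unfolding \<kappa>_eq by (simp add: j')
    also have "\<dots> = 1 / 2 * coeff G j + \<kappa> 1 / (2 * coeff (\<phi> 1) 0) * coeff G (j - 1)"
      unfolding \<Theta>_0 using c1 \<kappa>_nonzero[of 0] by simp
    \<comment> \<open>Orthogonality of \<open>\<phi> 1\<close> to 1 replaces this ratio by one of
      Toeplitz elements.\<close>
    also have "\<kappa> 1 / (2 * coeff (\<phi> 1) 0) = - (toeplitz_elem w 0 / (2 * toeplitz_elem w (-1)))"
      using w1 c1 w1_nz by (simp add: field_simps)
    finally show "(-1) ^ N * \<omega> 0 j =
        1 / 2 * coeff G j - toeplitz_elem w 0 / (2 * toeplitz_elem w (-1)) * coeff G (j-1)"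
      by simp
  qed

  have nz: "t j \<noteq> 0 \<and> f n j \<noteq> 0" if "j \<in> {1..N}" for n j
    using t_01[OF that] gen_\<Theta>_t[OF that, of n] gen_\<Theta>_1[of n] by (simp add: f_eq[OF that])
  have unique: "\<forall>n\<le>M. \<forall>j\<in>{1..N}. g n j = f n j \<and> v n j = \<omega> n j"
    if "initial_conditions N t w G g v \<and>
        (\<forall>n<M. \<forall>j\<in>{1..N}. f_relation N t \<rho>0 m g v n j) \<and>
        (\<forall>n\<in>{1..M}. \<forall>j\<in>{1..N}. omega_relation N t \<rho>0 m g v n j)" for M g v
    using recurrences_determine[OF nz init _ f_rel, of g v M] that omega_both by blast
  show ?thesis
    using den_nz omega_both G1 w1_nz f_rel init unique by blast
qed

end
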